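(* Let $A$ be a Banach algebra, and let $E$ be a Banach $A$-bimodule. (1) The following are equivalent: (a) $\widetilde H_K^2(A,E)=\{0\}$; (b) each singular Banach extension of $A$ by $E$ which cf-splits does split. (2) The following are equivalent: (a) $H_K^2(A,E)=\{0\}$; (b) each singular Banach extension of $A$ by $E$ which cf-splits strongly does split strongly.
   Context: Cocycles. Let $A$ be a Banach algebra and $E$ a Banach $A$-bimodule. For a linear map $S:A\to E$ put $\delta^1S(a,b)=a\cdot S(b)-S(ab)+S(a)\cdot b$; for a bilinear map $T:A\times A\to E$ put $\delta^2T(a,b,c)=a\cdot T(b,c)-T(ab,c)+T(a,bc)-T(a,b)\cdot c$. A bilinear map $T:A\times A\to E$ is compact if the norm closure of $\{T(a,b):\|a\|<1,\|b\|<1\}$ is compact. Set: $Z_K^2(A,E)$ = the compact bilinear $T$ with $\delta^2T=0$; $N_K^2(A,E)$ = the compact bilinear maps of the form $\delta^1S$ with $S:A\to E$ bounded linear; $\widetilde N_K^2(A,E)$ = the compact bilinear maps of the form $\delta^1S$ with $S:A\to E$ linear (not necessarily bounded); $H_K^2(A,E)=Z_K^2(A,E)/N_K^2(A,E)$; $\widetilde H_K^2(A,E)=Z_K^2(A,E)/\widetilde N_K^2(A,E)$. Extensions. A Banach extension of $A$ by $I$ is a short exact sequence $\Sigma:0\to I\xrightarrow{\iota}\mathfrak A\xrightarrow{q}A\to0$ of Banach algebras and bounded homomorphisms, with $\iota(I)$ a closed ideal in $\mathfrak A$. It is singular if $I^2=0$. If $\Sigma$ is singular, $I$ becomes an $A$-bimodule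 via $x\cdot q(a)=\iota(x)a$, $q(a)\cdot x=a\iota(x)$ (identifying $I$ with $\iota(I)$); $\Sigma$ is a singular Banach extension of $A$ by $E$ if $I$ with these operations is isomorphic to $E$ as a Banach $A$-bimodule. $\Sigma$ splits if there is an algebra homomorphism $\theta:A\to\mathfrak A$ with $q\circ\theta=\mathrm{id}_A$, and splits strongly if such a $\theta$ can be chosen continuous. For a linear map $Q:A\to\mathfrak A$ let $S_Q(a,b)=Q(a)Q(b)-Q(ab)$; $Q$ is a cf-homomorphism if the bilinear map $S_Q$ is compact. $\Sigma$ cf-splits if there is a cf-homomorphism $Q:A\to\mathfrak A$ with $q\circ Q=\mathrm{id}_A$, and cf-splits strongly if such a $Q$ can be chosen bounded. *)

theory Defs
  imports "HOL-Analysis.Abstract_Metric_Spaces" "HOL-Algebra.Module"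
begin

text \<open>
  Extensions have to be quantified over inside a formula, so Banach spaces and Banach algebras are
  structures with explicit carriers, built on the records of HOL-Algebra. The field \<open>one\<close> is never
  constrained (algebras need not be unital), and neither is \<open>mult\<close> where only a Banach space or a
  bimodule is meant. Maps between structures are only relevant on carriers.
\<close>

record ('k, 'v) normed_space = "('k, 'v) module" +
  nrm :: "'v \<Rightarrow> real"

record ('k, 'a, 'v) bimodule = "('k, 'v) normed_space" +
  lact :: "'a \<Rightarrow> 'v \<Rightarrow> 'v"
  ract :: "'v \<Rightarrow> 'a \<Rightarrow> 'v"

text \<open>The complete normed fields of class \<open>real_normed_field\<close> are exactly the real and the complex
  numbers, so the scalar type \<open>'k\<close> below covers both real and complex Banach algebras.\<close>

definition scalar_ring :: "'k::{real_normed_field, banach} ring" where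
  "scalar_ring = \<lparr>carrier = UNIV, monoid.mult = (*), one = 1, zero = 0, add = (+)\<rparr>"

text \<open>The locale \<open>Metric_space\<close> demands nonnegativity and symmetry also off the carrier, hence the
  conditional.\<close>

definition norm_dist :: "('k, 'v, 'x) normed_space_scheme \<Rightarrow> 'v \<Rightarrow> 'v \<Rightarrow> real" where
  "norm_dist V x y =
    (if x \<in> carrier V \<and> y \<in> carrier V then nrm V (x \<ominus>\<^bsub>V\<^esub> y) else 0)"

definition norm_topology :: "('k, 'v, 'x) normed_space_scheme \<Rightarrow> 'v topology" where
  "norm_topology V = Metric_space.mtopology (carrier V) (norm_dist V)"

locale banach_space = Module.module scalar_ring V
  for V :: "('k::{real_normed_field, banach}, 'v, 'x) normed_space_scheme" (structure) +
  assumes norm_nonneg: "x \<in> carrier V \<Longrightarrow> 0 \<le> nrm V x"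
    and norm_eq_zero: "x \<in> carrier V \<Longrightarrow> nrm V x = 0 \<longleftrightarrow> x = \<zero>\<^bsub>V\<^esub>"
    and norm_smult: "x \<in> carrier V \<Longrightarrow> nrm V (c \<odot>\<^bsub>V\<^esub> x) = norm c * nrm V x"
    and norm_triangle:
      "x \<in> carrier V \<Longrightarrow> y \<in> carrier V \<Longrightarrow> nrm V (x \<oplus>\<^bsub>V\<^esub> y) \<le> nrm V x + nrm V y"
    and complete: "Metric_space.mcomplete (carrier V) (norm_dist V)"

definition linear_map ::
  "('k, 'v, 'x) normed_space_scheme \<Rightarrow> ('k, 'w, 'y) normed_space_scheme \<Rightarrow> ('v \<Rightarrow> 'w) \<Rightarrow> bool" where
  "linear_map V W f \<longleftrightarrow>
    f \<in> carrier V \<rightarrow> carrier W \<and>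
    (\<forall>x\<in>carrier V. \<forall>y\<in>carrier V. f (x \<oplus>\<^bsub>V\<^esub> y) = f x \<oplus>\<^bsub>W\<^esub> f y) \<and>
    (\<forall>c. \<forall>x\<in>carrier V. f (c \<odot>\<^bsub>V\<^esub> x) = c \<odot>\<^bsub>W\<^esub> f x)"

definition bounded_map ::
  "('k, 'v, 'x) normed_space_scheme \<Rightarrow> ('k, 'w, 'y) normed_space_scheme \<Rightarrow> ('v \<Rightarrow> 'w) \<Rightarrow> bool" where
  "bounded_map V W f \<longleftrightarrow> (\<exists>K. \<forall>x\<in>carrier V. nrm W (f x) \<le> K * nrm V x)"

definition bilinear_map ::
  "('k, 'u, 'x) normed_space_scheme \<Rightarrow> ('k, 'v, 'y) normed_space_scheme \<Rightarrow>
   ('k, 'w, 'z) normed_space_scheme \<Rightarrow> ('u \<Rightarrow> 'v \<Rightarrow> 'w) \<Rightarrow> bool" where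
  "bilinear_map U V W T \<longleftrightarrow>
    (\<forall>x\<in>carrier U. linear_map V W (T x)) \<and> (\<forall>y\<in>carrier V. linear_map U W (\<lambda>x. T x y))"

definition compact_bilinear_map ::
  "('k, 'u, 'x) normed_space_scheme \<Rightarrow> ('k, 'v, 'y) normed_space_scheme \<Rightarrow>
   ('k, 'w, 'z) normed_space_scheme \<Rightarrow> ('u \<Rightarrow> 'v \<Rightarrow> 'w) \<Rightarrow> bool" where
  "compact_bilinear_map U V W T \<longleftrightarrow>
    bilinear_map U V W T \<and>
    compactin (norm_topology W)
      (norm_topology W closure_of
        {T x y | x y. x \<in> carrier U \<and> y \<in> carrier V \<and> nrm U x < 1 \<and> nrm V y < 1})"

locale banach_algebra = banach_space A
  for A :: "('k::{real_normed_field, banach}, 'a, 'x) normed_space_scheme" (structure) +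
  assumes mult_bilinear: "bilinear_map A A A (monoid.mult A)"
    and mult_assoc:
      "x \<in> carrier A \<Longrightarrow> y \<in> carrier A \<Longrightarrow> z \<in> carrier A \<Longrightarrow>
       (x \<otimes>\<^bsub>A\<^esub> y) \<otimes>\<^bsub>A\<^esub> z = x \<otimes>\<^bsub>A\<^esub> (y \<otimes>\<^bsub>A\<^esub> z)"
    and norm_mult:
      "x \<in> carrier A \<Longrightarrow> y \<in> carrier A \<Longrightarrow> nrm A (x \<otimes>\<^bsub>A\<^esub> y) \<le> nrm A x * nrm A y"

locale banach_bimodule = A: banach_algebra A + E: banach_space E
  for A :: "('k::{real_normed_field, banach}, 'a, 'x) normed_space_scheme"
    and E :: "('k, 'a, 'e, 'y) bimodule_scheme" +
  assumes lact_bilinear: "bilinear_map A E E (lact E)"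
    and ract_bilinear: "bilinear_map E A E (ract E)"
    and lact_assoc:
      "a \<in> carrier A \<Longrightarrow> b \<in> carrier A \<Longrightarrow> x \<in> carrier E \<Longrightarrow>
       lact E (a \<otimes>\<^bsub>A\<^esub> b) x = lact E a (lact E b x)"
    and ract_assoc:
      "a \<in> carrier A \<Longrightarrow> b \<in> carrier A \<Longrightarrow> x \<in> carrier E \<Longrightarrow>
       ract E x (a \<otimes>\<^bsub>A\<^esub> b) = ract E (ract E x a) b"
    and lact_ract:
      "a \<in> carrier A \<Longrightarrow> b \<in> carrier A \<Longrightarrow> x \<in> carrier E \<Longrightarrow>
       ract E (lact E a x) b = lact E a (ract E x b)"
    and actions_bounded:
      "\<exists>K. \<forall>a\<in>carrier A. \<forall>x\<in>carrier E.
         nrm E (lact E a x) \<le> K * nrm A a * nrm E x \<and>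
         nrm E (ract E x a) \<le> K * nrm A a * nrm E x"

section \<open>Compact second cohomology\<close>

definition delta1 ::
  "('k, 'a, 'x) normed_space_scheme \<Rightarrow> ('k, 'a, 'e, 'y) bimodule_scheme \<Rightarrow>
   ('a \<Rightarrow> 'e) \<Rightarrow> 'a \<Rightarrow> 'a \<Rightarrow> 'e" where
  "delta1 A E S a b = lact E a (S b) \<ominus>\<^bsub>E\<^esub> S (a \<otimes>\<^bsub>A\<^esub> b) \<oplus>\<^bsub>E\<^esub> ract E (S a) b"

definition delta2 ::
  "('k, 'a, 'x) normed_space_scheme \<Rightarrow> ('k, 'a, 'e, 'y) bimodule_scheme \<Rightarrow>
   ('a \<Rightarrow> 'a \<Rightarrow> 'e) \<Rightarrow> 'a \<Rightarrow> 'a \<Rightarrow> 'a \<Rightarrow> 'e" where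
  "delta2 A E T a b c =
    lact E a (T b c) \<ominus>\<^bsub>E\<^esub> T (a \<otimes>\<^bsub>A\<^esub> b) c \<oplus>\<^bsub>E\<^esub> T a (b \<otimes>\<^bsub>A\<^esub> c) \<ominus>\<^bsub>E\<^esub> ract E (T a b) c"

definition Z2K ::
  "('k, 'a, 'x) normed_space_scheme \<Rightarrow> ('k, 'a, 'e, 'y) bimodule_scheme \<Rightarrow> ('a \<Rightarrow> 'a \<Rightarrow> 'e) set" where
  "Z2K A E = {T. compact_bilinear_map A A E T \<and>
    (\<forall>a\<in>carrier A. \<forall>b\<in>carrier A. \<forall>c\<in>carrier A. delta2 A E T a b c = \<zero>\<^bsub>E\<^esub>)}"

definition N2K ::
  "('k, 'a, 'x) normed_space_scheme \<Rightarrow> ('k, 'a, 'e, 'y) bimodule_scheme \<Rightarrow> ('a \<Rightarrow> 'a \<Rightarrow> 'e) set" where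
  "N2K A E = {T. compact_bilinear_map A A E T \<and>
    (\<exists>S. linear_map A E S \<and> bounded_map A E S \<and>
      (\<forall>a\<in>carrier A. \<forall>b\<in>carrier A. T a b = delta1 A E S a b))}"

definition N2K_tilde ::
  "('k, 'a, 'x) normed_space_scheme \<Rightarrow> ('k, 'a, 'e, 'y) bimodule_scheme \<Rightarrow> ('a \<Rightarrow> 'a \<Rightarrow> 'e) set" where
  "N2K_tilde A E = {T. compact_bilinear_map A A E T \<and>
    (\<exists>S. linear_map A E S \<and> (\<forall>a\<in>carrier A. \<forall>b\<in>carrier A. T a b = delta1 A E S a b))}"

text \<open>Two maps agreeing on the carrier of \<open>A\<close> are congruent, since \<open>N\<close> contains every map that
  vanishes there.\<close>

definition cong_mod ::
  "('k, 'a, 'e, 'y) bimodule_scheme \<Rightarrow> ('a \<Rightarrow> 'a \<Rightarrow> 'e) set \<Rightarrow> ('a \<Rightarrow> 'a \<Rightarrow> 'e) set \<Rightarrow>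
   (('a \<Rightarrow> 'a \<Rightarrow> 'e) \<times> ('a \<Rightarrow> 'a \<Rightarrow> 'e)) set" where
  "cong_mod E Z N = {(T, T'). T \<in> Z \<and> T' \<in> Z \<and> (\<lambda>a b. T a b \<ominus>\<^bsub>E\<^esub> T' a b) \<in> N}"

definition zero_coset ::
  "('k, 'a, 'e, 'y) bimodule_scheme \<Rightarrow> ('a \<Rightarrow> 'a \<Rightarrow> 'e) set \<Rightarrow> ('a \<Rightarrow> 'a \<Rightarrow> 'e) set \<Rightarrow>
   ('a \<Rightarrow> 'a \<Rightarrow> 'e) set" where
  "zero_coset E Z N = cong_mod E Z N `` {\<lambda>a b. \<zero>\<^bsub>E\<^esub>}"

definition H2K ::
  "('k, 'a, 'x) normed_space_scheme \<Rightarrow> ('k, 'a, 'e, 'y) bimodule_scheme \<Rightarrow>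
   ('a \<Rightarrow> 'a \<Rightarrow> 'e) set set" where
  "H2K A E = Z2K A E // cong_mod E (Z2K A E) (N2K A E)"

definition H2K_tilde ::
  "('k, 'a, 'x) normed_space_scheme \<Rightarrow> ('k, 'a, 'e, 'y) bimodule_scheme \<Rightarrow>
   ('a \<Rightarrow> 'a \<Rightarrow> 'e) set set" where
  "H2K_tilde A E = Z2K A E // cong_mod E (Z2K A E) (N2K_tilde A E)"

section \<open>Extensions\<close>

definition algebra_hom ::
  "('k, 'a, 'x) normed_space_scheme \<Rightarrow> ('k, 'b, 'y) normed_space_scheme \<Rightarrow> ('a \<Rightarrow> 'b) \<Rightarrow> bool" where
  "algebra_hom A B f \<longleftrightarrow>
    linear_map A B f \<and>
    (\<forall>x\<in>carrier A. \<forall>y\<in>carrier A. f (x \<otimes>\<^bsub>A\<^esub> y) = f x \<otimes>\<^bsub>B\<^esub> f y)"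

definition closed_ideal ::
  "'v set \<Rightarrow> ('k::{real_normed_field, banach}, 'v, 'x) normed_space_scheme \<Rightarrow> bool" where
  "closed_ideal J B \<longleftrightarrow>
    submodule J scalar_ring B \<and>
    (\<forall>x\<in>J. \<forall>b\<in>carrier B. x \<otimes>\<^bsub>B\<^esub> b \<in> J \<and> b \<otimes>\<^bsub>B\<^esub> x \<in> J) \<and>
    closedin (norm_topology B) J"

locale banach_extension = I: banach_algebra I + B: banach_algebra B + A: banach_algebra A
  for I :: "('k::{real_normed_field, banach}, 'i, 'x) normed_space_scheme"
    and \<iota> :: "'i \<Rightarrow> 'b"
    and B :: "('k, 'b, 'y) normed_space_scheme"
    and q :: "'b \<Rightarrow> 'a"
    and A :: "('k, 'a, 'z) normed_space_scheme" +
  assumes iota_hom: "algebra_hom I B \<iota>"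
    and iota_bounded: "bounded_map I B \<iota>"
    and q_hom: "algebra_hom B A q"
    and q_bounded: "bounded_map B A q"
    and iota_inj: "inj_on \<iota> (carrier I)"
    and exact: "\<iota> ` carrier I = {b \<in> carrier B. q b = \<zero>\<^bsub>A\<^esub>}"
    and q_surj: "q ` carrier B = carrier A"
    and ideal_closed: "closed_ideal (\<iota> ` carrier I) B"

locale singular_extension = banach_extension +
  assumes square_zero: "x \<in> carrier I \<Longrightarrow> y \<in> carrier I \<Longrightarrow> x \<otimes>\<^bsub>I\<^esub> y = \<zero>\<^bsub>I\<^esub>"

text \<open>The kernel of a singular extension with the operations \<open>x \<cdot> q b = \<iota> x b\<close> and
  \<open>q b \<cdot> x = b \<iota> x\<close>; these do not depend on the choice of \<open>b\<close> because the kernel has zero product.\<close>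

definition kernel_bimodule ::
  "('k, 'i) normed_space \<Rightarrow> ('i \<Rightarrow> 'b) \<Rightarrow> ('k, 'b, 'y) normed_space_scheme \<Rightarrow> ('b \<Rightarrow> 'a) \<Rightarrow>
   ('k, 'a, 'i) bimodule" where
  "kernel_bimodule I \<iota> B q =
    normed_space.extend I
      (bimodule.fields
        (\<lambda>a x. THE y. y \<in> carrier I \<and> (\<forall>b\<in>carrier B. q b = a \<longrightarrow> \<iota> y = b \<otimes>\<^bsub>B\<^esub> \<iota> x))
        (\<lambda>x a. THE y. y \<in> carrier I \<and> (\<forall>b\<in>carrier B. q b = a \<longrightarrow> \<iota> y = \<iota> x \<otimes>\<^bsub>B\<^esub> b)))"

definition bimodule_iso ::
  "('k, 'a, 'x) normed_space_scheme \<Rightarrow> ('k, 'a, 'v, 'y) bimodule_scheme \<Rightarrow>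
   ('k, 'a, 'w, 'z) bimodule_scheme \<Rightarrow> ('v \<Rightarrow> 'w) \<Rightarrow> bool" where
  "bimodule_iso A E F \<phi> \<longleftrightarrow>
    linear_map E F \<phi> \<and> bij_betw \<phi> (carrier E) (carrier F) \<and>
    bounded_map E F \<phi> \<and> bounded_map F E (inv_into (carrier E) \<phi>) \<and>
    (\<forall>a\<in>carrier A. \<forall>x\<in>carrier E.
      \<phi> (lact E a x) = lact F a (\<phi> x) \<and> \<phi> (ract E x a) = ract F (\<phi> x) a)"

definition singular_extension_by ::
  "('k::{real_normed_field, banach}, 'a, 'x) normed_space_scheme \<Rightarrow>
   ('k, 'a, 'e, 'y) bimodule_scheme \<Rightarrow> ('k, 'i) normed_space \<Rightarrow> ('i \<Rightarrow> 'b) \<Rightarrow>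
   ('k, 'b) normed_space \<Rightarrow> ('b \<Rightarrow> 'a) \<Rightarrow> bool" where
  "singular_extension_by A E I \<iota> B q \<longleftrightarrow>
    singular_extension I \<iota> B q A \<and> (\<exists>\<phi>. bimodule_iso A (kernel_bimodule I \<iota> B q) E \<phi>)"

definition splits ::
  "('k, 'a, 'x) normed_space_scheme \<Rightarrow> ('k, 'b, 'y) normed_space_scheme \<Rightarrow> ('b \<Rightarrow> 'a) \<Rightarrow> bool" where
  "splits A B q \<longleftrightarrow> (\<exists>\<theta>. algebra_hom A B \<theta> \<and> (\<forall>a\<in>carrier A. q (\<theta> a) = a))"

definition splits_strongly ::
  "('k, 'a, 'x) normed_space_scheme \<Rightarrow> ('k, 'b, 'y) normed_space_scheme \<Rightarrow> ('b \<Rightarrow> 'a) \<Rightarrow> bool" where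
  "splits_strongly A B q \<longleftrightarrow>
    (\<exists>\<theta>. algebra_hom A B \<theta> \<and> continuous_map (norm_topology A) (norm_topology B) \<theta> \<and>
      (\<forall>a\<in>carrier A. q (\<theta> a) = a))"

definition cf_homomorphism ::
  "('k, 'a, 'x) normed_space_scheme \<Rightarrow> ('k, 'b, 'y) normed_space_scheme \<Rightarrow> ('a \<Rightarrow> 'b) \<Rightarrow> bool" where
  "cf_homomorphism A B Q \<longleftrightarrow>
    linear_map A B Q \<and>
    compact_bilinear_map A A B (\<lambda>a b. Q a \<otimes>\<^bsub>B\<^esub> Q b \<ominus>\<^bsub>B\<^esub> Q (a \<otimes>\<^bsub>A\<^esub> b))"

definition cf_splits ::
  "('k, 'a, 'x) normed_space_scheme \<Rightarrow> ('k, 'b, 'y) normed_space_scheme \<Rightarrow> ('b \<Rightarrow> 'a) \<Rightarrow> bool" where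
  "cf_splits A B q \<longleftrightarrow> (\<exists>Q. cf_homomorphism A B Q \<and> (\<forall>a\<in>carrier A. q (Q a) = a))"

definition cf_splits_strongly ::
  "('k, 'a, 'x) normed_space_scheme \<Rightarrow> ('k, 'b, 'y) normed_space_scheme \<Rightarrow> ('b \<Rightarrow> 'a) \<Rightarrow> bool" where
  "cf_splits_strongly A B q \<longleftrightarrow>
    (\<exists>Q. cf_homomorphism A B Q \<and> bounded_map A B Q \<and> (\<forall>a\<in>carrier A. q (Q a) = a))"

text \<open>
  HOL cannot quantify over types within a formula, so the quantifier over all extensions has to range over structures
  whose carriers are subsets of one type \<open>'u\<close>. Since \<open>B\<close> is in bijection with \<open>E \<times> A\<close> for every
  extension \<open>B\<close> of \<open>A\<close> by \<open>E\<close>, all of them occur up to isomorphism as soon as \<open>E \<times> A\<close> embeds into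
  \<open>'u\<close>. Such a \<open>'u\<close> always exists: take \<open>'e \<times> 'a\<close> with the identity.
\<close>

definition embeds_in_universe ::
  "('k, 'a, 'e, 'y) bimodule_scheme \<Rightarrow> ('k, 'a, 'x) normed_space_scheme \<Rightarrow> 'u itself \<Rightarrow> bool" where
  "embeds_in_universe E A (_ :: 'u itself) \<longleftrightarrow>
    (\<exists>j :: 'e \<times> 'a \<Rightarrow> 'u. inj_on j (carrier E \<times> carrier A))"

end

theory Submission
  imports Defs "HOL-Analysis.Urysohn"
begin

text \<open>
  A cf-section \<open>Q\<close> of a singular extension of \<open>A\<close> by \<open>E\<close> has \<open>S_Q\<close> with values in the kernel, so
  \<open>S_Q\<close> pulls back to a 2-cocycle \<open>T\<close> with values in \<open>E\<close>; the pullback stays compact because the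
  embedding of \<open>E\<close> as a closed ideal has a bounded inverse by the open mapping theorem. If
  \<open>T = delta1 S\<close>, then \<open>Q - S\<close> is a homomorphic section. Conversely, a compact 2-cocycle \<open>T\<close> twists
  the product on \<open>E \<times> A\<close> to \<open>(x, a)(y, b) = (x b + a y + T a b, a b)\<close>; the section \<open>a \<mapsto> (0, a)\<close> of this
  extension has defect \<open>(T, 0)\<close>, and a homomorphic section \<open>a \<mapsto> (R a, a)\<close> means \<open>T = delta1 (- R)\<close>.
  Boundedness is preserved in both directions.
\<close>

section \<open>The open mapping theorem with explicit carriers\<close>

text \<open>Two points need analysis rather than algebra. The embedding \<open>\<iota>\<close> of an
  extension comes without a lower bound, although only such a bound lets compactness descend from
  \<open>B\<close> to \<open>E\<close>. And in part (1) neither the section \<open>Q\<close> nor the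
  primitive \<open>S\<close> need be bounded, while the twisted product on
  \<open>E \<times> A\<close> still has to be a Banach algebra. What saves it is that a compact
  bilinear map is automatically bounded, so the norm on \<open>E \<times> A\<close> can be weighted
  until the product is submultiplicative. The same constructions therefore serve both parts, and
  boundedness of sections and primitives is carried along as an implication. Compactness is treated
  as total boundedness, because that passes from one target space to another by a mere norm estimate
  on differences.\<close>

lemma scalar_ring_simps [simp]:
  "carrier scalar_ring = UNIV"
  "add scalar_ring = (+)"
  "monoid.mult scalar_ring = (*)"
  "one scalar_ring = 1"
  "zero scalar_ring = 0"
  by (simp_all add: scalar_ring_def)

section \<open>Normed modules: arithmetic, metric and completeness\<close>

text \<open>Completeness is split off because the closed ideals and the twisted product below are
  first known as normed modules, and the metric of a normed module is already used in proving them
  complete.\<close>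

locale normed_module = Module.module scalar_ring V
  for V :: "('k::{real_normed_field, banach}, 'v, 'x) normed_space_scheme" (structure) +
  assumes nrm_nonneg [simp]: "x \<in> carrier V \<Longrightarrow> 0 \<le> nrm V x"
    and nrm_eq_zero [simp]: "x \<in> carrier V \<Longrightarrow> nrm V x = 0 \<longleftrightarrow> x = \<zero>\<^bsub>V\<^esub>"
    and nrm_smult [simp]: "x \<in> carrier V \<Longrightarrow> nrm V (c \<odot>\<^bsub>V\<^esub> x) = norm c * nrm V x"
    and nrm_triangle:
      "x \<in> carrier V \<Longrightarrow> y \<in> carrier V \<Longrightarrow> nrm V (x \<oplus>\<^bsub>V\<^esub> y) \<le> nrm V x + nrm V y"
begin

lemma smult_mem [simp, intro]: "x \<in> carrier V \<Longrightarrow> c \<odot>\<^bsub>V\<^esub> x \<in> carrier V"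
  using smult_closed[of c x] by simp

lemma smult_smult [simp]: "x \<in> carrier V \<Longrightarrow> a \<odot>\<^bsub>V\<^esub> (b \<odot>\<^bsub>V\<^esub> x) = (a * b) \<odot>\<^bsub>V\<^esub> x"
  using smult_assoc1[of a b x] by simp

lemma one_smult [simp]: "x \<in> carrier V \<Longrightarrow> 1 \<odot>\<^bsub>V\<^esub> x = x"
  using smult_one[of x] by simp

lemma zero_smult [simp]: "x \<in> carrier V \<Longrightarrow> 0 \<odot>\<^bsub>V\<^esub> x = \<zero>\<^bsub>V\<^esub>"
  using smult_l_null[of x] by simp

lemma smult_zero [simp]: "c \<odot>\<^bsub>V\<^esub> \<zero>\<^bsub>V\<^esub> = \<zero>\<^bsub>V\<^esub>"
  using smult_r_null[of c] by simp

lemma uminus_eq_smult: "x \<in> carrier V \<Longrightarrow> \<ominus>\<^bsub>V\<^esub> x = (-1) \<odot>\<^bsub>V\<^esub> x"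
proof -
  assume x: "x \<in> carrier V"
  have "(-1) \<odot>\<^bsub>V\<^esub> x \<oplus>\<^bsub>V\<^esub> x = (-1 + 1) \<odot>\<^bsub>V\<^esub> x"
    using x smult_l_distr[of "-1" 1 x] by simp
  also have "\<dots> = \<zero>\<^bsub>V\<^esub>"
    using x by simp
  finally show ?thesis
    using x by (intro M.minus_equality) auto
qed

lemma uminus_zero [simp]: "\<ominus>\<^bsub>V\<^esub> \<zero>\<^bsub>V\<^esub> = \<zero>\<^bsub>V\<^esub>"
  by (simp add: uminus_eq_smult)

lemma minus_zero [simp]: "x \<in> carrier V \<Longrightarrow> x \<ominus>\<^bsub>V\<^esub> \<zero>\<^bsub>V\<^esub> = x"
  by (simp add: M.minus_eq)

lemma minus_self [simp]: "x \<in> carrier V \<Longrightarrow> x \<ominus>\<^bsub>V\<^esub> x = \<zero>\<^bsub>V\<^esub>"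
  by (simp add: M.minus_eq M.r_neg)

lemma minus_add_eq:
  "x \<in> carrier V \<Longrightarrow> y \<in> carrier V \<Longrightarrow> z \<in> carrier V \<Longrightarrow>
    x \<ominus>\<^bsub>V\<^esub> (y \<oplus>\<^bsub>V\<^esub> z) = x \<ominus>\<^bsub>V\<^esub> y \<ominus>\<^bsub>V\<^esub> z"
  by (simp add: M.minus_eq M.minus_add M.a_assoc)

lemma nrm_zero [simp]: "nrm V \<zero>\<^bsub>V\<^esub> = 0"
  by simp

lemma nrm_uminus [simp]: "x \<in> carrier V \<Longrightarrow> nrm V (\<ominus>\<^bsub>V\<^esub> x) = nrm V x"
  by (simp add: uminus_eq_smult)

lemma nrm_le_zero: "x \<in> carrier V \<Longrightarrow> nrm V x \<le> 0 \<longleftrightarrow> x = \<zero>\<^bsub>V\<^esub>"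
  using nrm_nonneg[of x] nrm_eq_zero[of x] by linarith

lemma minus_minus_swap:
  "x \<in> carrier V \<Longrightarrow> y \<in> carrier V \<Longrightarrow> \<ominus>\<^bsub>V\<^esub> (x \<ominus>\<^bsub>V\<^esub> y) = y \<ominus>\<^bsub>V\<^esub> x"
  by (simp add: M.minus_eq M.minus_add M.a_comm)

lemma nrm_minus_commute:
  "x \<in> carrier V \<Longrightarrow> y \<in> carrier V \<Longrightarrow> nrm V (x \<ominus>\<^bsub>V\<^esub> y) = nrm V (y \<ominus>\<^bsub>V\<^esub> x)"
  by (metis minus_minus_swap nrm_uminus M.minus_closed)

lemma minus_add_cancel:
  "x \<in> carrier V \<Longrightarrow> y \<in> carrier V \<Longrightarrow> x \<ominus>\<^bsub>V\<^esub> y \<oplus>\<^bsub>V\<^esub> y = x"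
  by (simp add: M.minus_eq M.a_assoc M.l_neg)

lemma minus_trans:
  "x \<in> carrier V \<Longrightarrow> y \<in> carrier V \<Longrightarrow> z \<in> carrier V \<Longrightarrow>
    (x \<ominus>\<^bsub>V\<^esub> y) \<oplus>\<^bsub>V\<^esub> (y \<ominus>\<^bsub>V\<^esub> z) = x \<ominus>\<^bsub>V\<^esub> z"
  by (simp add: M.minus_eq M.a_assoc M.r_neg1)

lemma minus_eq_zero_iff:
  "x \<in> carrier V \<Longrightarrow> y \<in> carrier V \<Longrightarrow> x \<ominus>\<^bsub>V\<^esub> y = \<zero>\<^bsub>V\<^esub> \<longleftrightarrow> x = y"
  by (metis M.l_zero M.minus_eq M.r_neg minus_add_cancel)

lemma minus_eq_iff:
  "x \<in> carrier V \<Longrightarrow> y \<in> carrier V \<Longrightarrow> z \<in> carrier V \<Longrightarrow>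
    x \<ominus>\<^bsub>V\<^esub> y = z \<longleftrightarrow> x = z \<oplus>\<^bsub>V\<^esub> y"
  by (auto simp: minus_add_cancel M.minus_eq M.a_assoc M.r_neg M.l_neg)

lemma add_minus_add:
  "x \<in> carrier V \<Longrightarrow> y \<in> carrier V \<Longrightarrow> x' \<in> carrier V \<Longrightarrow> y' \<in> carrier V \<Longrightarrow>
    (x \<oplus>\<^bsub>V\<^esub> y) \<ominus>\<^bsub>V\<^esub> (x' \<oplus>\<^bsub>V\<^esub> y') = (x \<ominus>\<^bsub>V\<^esub> x') \<oplus>\<^bsub>V\<^esub> (y \<ominus>\<^bsub>V\<^esub> y')"
  by (simp add: M.minus_eq M.minus_add M.a_ac)

lemma minus_minus_minus:
  "x \<in> carrier V \<Longrightarrow> y \<in> carrier V \<Longrightarrow> x' \<in> carrier V \<Longrightarrow> y' \<in> carrier V \<Longrightarrow>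
    (x \<ominus>\<^bsub>V\<^esub> y) \<ominus>\<^bsub>V\<^esub> (x' \<ominus>\<^bsub>V\<^esub> y') = (x \<ominus>\<^bsub>V\<^esub> x') \<ominus>\<^bsub>V\<^esub> (y \<ominus>\<^bsub>V\<^esub> y')"
  by (simp add: M.minus_eq M.minus_add M.a_ac)

lemma nrm_triangle_minus:
  "x \<in> carrier V \<Longrightarrow> y \<in> carrier V \<Longrightarrow> nrm V (x \<ominus>\<^bsub>V\<^esub> y) \<le> nrm V x + nrm V y"
  using nrm_triangle[of x "\<ominus>\<^bsub>V\<^esub> y"] by (simp add: M.minus_eq)

lemma nrm_le_add_minus:
  "x \<in> carrier V \<Longrightarrow> y \<in> carrier V \<Longrightarrow> nrm V x \<le> nrm V (x \<ominus>\<^bsub>V\<^esub> y) + nrm V y"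
  using nrm_triangle[of "x \<ominus>\<^bsub>V\<^esub> y" y] by (simp add: minus_add_cancel)

lemma smult_minus:
  "x \<in> carrier V \<Longrightarrow> y \<in> carrier V \<Longrightarrow> c \<odot>\<^bsub>V\<^esub> (x \<ominus>\<^bsub>V\<^esub> y) = c \<odot>\<^bsub>V\<^esub> x \<ominus>\<^bsub>V\<^esub> c \<odot>\<^bsub>V\<^esub> y"
  by (simp add: M.minus_eq smult_r_distr smult_r_minus)

lemma norm_dist_eq:
  "x \<in> carrier V \<Longrightarrow> y \<in> carrier V \<Longrightarrow> norm_dist V x y = nrm V (x \<ominus>\<^bsub>V\<^esub> y)"
  by (simp add: norm_dist_def)

sublocale metric: Metric_space "carrier V" "norm_dist V"
proof
  show "0 \<le> norm_dist V x y" for x y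
    by (simp add: norm_dist_def)
  show "norm_dist V x y = norm_dist V y x" for x y
    using nrm_minus_commute[of x y] by (auto simp: norm_dist_def)
  show "norm_dist V x y = 0 \<longleftrightarrow> x = y" if "x \<in> carrier V" "y \<in> carrier V" for x y
    using that by (simp add: norm_dist_def minus_eq_zero_iff)
  show "norm_dist V x z \<le> norm_dist V x y + norm_dist V y z"
    if "x \<in> carrier V" "y \<in> carrier V" "z \<in> carrier V" for x y z
    using that nrm_triangle[of "x \<ominus>\<^bsub>V\<^esub> y" "y \<ominus>\<^bsub>V\<^esub> z"]
    by (simp add: norm_dist_def minus_trans)
qed

lemma norm_topology_eq: "norm_topology V = metric.mtopology"
  by (simp add: norm_topology_def)

text \<open>States completeness through norms of differences, so that for a product it can be
  checked coordinate by coordinate and for an ideal in the ambient algebra.\<close>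

lemma mcompleteI:
  assumes "\<And>\<sigma>. \<lbrakk>\<And>n. \<sigma> n \<in> carrier V;
      \<And>e. 0 < e \<Longrightarrow> \<exists>N. \<forall>m\<ge>N. \<forall>n\<ge>N. nrm V (\<sigma> m \<ominus>\<^bsub>V\<^esub> \<sigma> n) < e\<rbrakk> \<Longrightarrow>
      \<exists>l\<in>carrier V. (\<lambda>n. nrm V (\<sigma> n \<ominus>\<^bsub>V\<^esub> l)) \<longlonglongrightarrow> 0"
  shows "metric.mcomplete"
  unfolding metric.mcomplete_def
proof (intro allI impI)
  fix \<sigma> assume "metric.MCauchy \<sigma>"
  then have mem: "\<sigma> n \<in> carrier V" and
    cauchy: "0 < e \<Longrightarrow> \<exists>N. \<forall>m n. N \<le> m \<longrightarrow> N \<le> n \<longrightarrow> norm_dist V (\<sigma> m) (\<sigma> n) < e" for n e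
    by (simp_all add: metric.MCauchy_def image_subset_iff)
  have "\<exists>N. \<forall>m\<ge>N. \<forall>n\<ge>N. nrm V (\<sigma> m \<ominus>\<^bsub>V\<^esub> \<sigma> n) < e" if "0 < e" for e
    using cauchy[OF that] mem by (simp add: norm_dist_eq)
  then obtain l where l: "l \<in> carrier V" "(\<lambda>n. nrm V (\<sigma> n \<ominus>\<^bsub>V\<^esub> l)) \<longlonglongrightarrow> 0"
    using assms[of \<sigma>] mem by blast
  then show "\<exists>l. limitin metric.mtopology \<sigma> l sequentially"
    using mem by (auto simp: metric.limitin_metric_dist_null norm_dist_eq intro!: exI[of _ l])
qed

end

sublocale banach_space \<subseteq> normed_module
  by unfold_locales (auto simp: norm_eq_zero norm_smult norm_nonneg intro: norm_triangle)

lemma (in banach_space) cauchy_convergent: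
  assumes mem: "\<And>n. \<sigma> n \<in> carrier V"
    and cauchy: "\<And>e. 0 < e \<Longrightarrow> \<exists>N. \<forall>m\<ge>N. \<forall>n\<ge>N. nrm V (\<sigma> m \<ominus>\<^bsub>V\<^esub> \<sigma> n) < e"
  shows "\<exists>l\<in>carrier V. (\<lambda>n. nrm V (\<sigma> n \<ominus>\<^bsub>V\<^esub> l)) \<longlonglongrightarrow> 0"
proof -
  have "metric.MCauchy \<sigma>"
    unfolding metric.MCauchy_def using mem cauchy by (auto simp: norm_dist_eq)
  then obtain l where "limitin metric.mtopology \<sigma> l sequentially"
    using complete by (auto simp: metric.mcomplete_def)
  then show ?thesis
    using mem by (auto simp: metric.limitin_metric_dist_null norm_dist_eq)
qed

section \<open>Linear maps: boundedness and continuity\<close>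

locale normed_linear = V: normed_module V + W: normed_module W
  for V :: "('k::{real_normed_field, banach}, 'v, 'x) normed_space_scheme"
    and W :: "('k, 'w, 'y) normed_space_scheme"
    and f :: "'v \<Rightarrow> 'w" +
  assumes linear: "linear_map V W f"
begin

lemma closed [simp, intro]: "x \<in> carrier V \<Longrightarrow> f x \<in> carrier W"
  using linear by (auto simp: linear_map_def)

lemma add [simp]: "x \<in> carrier V \<Longrightarrow> y \<in> carrier V \<Longrightarrow> f (x \<oplus>\<^bsub>V\<^esub> y) = f x \<oplus>\<^bsub>W\<^esub> f y"
  using linear by (auto simp: linear_map_def)

lemma smult [simp]: "x \<in> carrier V \<Longrightarrow> f (c \<odot>\<^bsub>V\<^esub> x) = c \<odot>\<^bsub>W\<^esub> f x"
  using linear by (auto simp: linear_map_def)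

lemma uminus [simp]: "x \<in> carrier V \<Longrightarrow> f (\<ominus>\<^bsub>V\<^esub> x) = \<ominus>\<^bsub>W\<^esub> f x"
  by (simp add: V.uminus_eq_smult W.uminus_eq_smult)

lemma minus [simp]: "x \<in> carrier V \<Longrightarrow> y \<in> carrier V \<Longrightarrow> f (x \<ominus>\<^bsub>V\<^esub> y) = f x \<ominus>\<^bsub>W\<^esub> f y"
  by (simp add: V.M.minus_eq W.M.minus_eq)

lemma zero [simp]: "f \<zero>\<^bsub>V\<^esub> = \<zero>\<^bsub>W\<^esub>"
proof -
  have "f (0 \<odot>\<^bsub>V\<^esub> \<zero>\<^bsub>V\<^esub>) = \<zero>\<^bsub>W\<^esub>"
    by (subst smult) simp_all
  then show ?thesis
    by simp
qed

text \<open>Scaling a nonzero \<open>x\<close> to norm \<open>r / 2\<close> puts it strictly inside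
  the ball; this costs the factor 2.\<close>

lemma bounded_if_bounded_on_ball:
  assumes "0 < r" and "\<And>x. x \<in> carrier V \<Longrightarrow> nrm V x < r \<Longrightarrow> nrm W (f x) \<le> C"
    and "x \<in> carrier V"
  shows "nrm W (f x) \<le> 2 * C / r * nrm V x"
proof (cases "x = \<zero>\<^bsub>V\<^esub>")
  case False
  with assms have n: "0 < nrm V x"
    by (metis V.nrm_eq_zero V.nrm_nonneg less_eq_real_def)
  define t where "t = r / (2 * nrm V x)"
  have t: "0 < t"
    using n assms by (simp add: t_def)
  have "t * nrm V x < r"
    using n assms by (simp add: t_def)
  then have "nrm W (f (of_real t \<odot>\<^bsub>V\<^esub> x)) \<le> C"
    using assms t by (intro assms(2)) auto
  then have "t * nrm W (f x) \<le> C"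
    using assms t by simp
  then show ?thesis
    using n assms(1) by (simp add: t_def field_simps)
qed simp

text \<open>Strong splitting asks for a continuous homomorphism, whereas cochains and cf-sections
  are measured by bounds; this connects the two.\<close>

lemma continuous_iff_bounded:
  "continuous_map (norm_topology V) (norm_topology W) f \<longleftrightarrow> bounded_map V W f"
proof
  assume "continuous_map (norm_topology V) (norm_topology W) f"
  then have "\<forall>e>0. \<exists>d>0. \<forall>x. x \<in> carrier V \<and> norm_dist V \<zero>\<^bsub>V\<^esub> x < d \<longrightarrow>
      norm_dist W (f \<zero>\<^bsub>V\<^esub>) (f x) < e"
    by (auto simp del: zero simp: V.norm_topology_eq W.norm_topology_eq
        V.metric.metric_continuous_map[OF W.metric.Metric_space_axioms])
  then obtain d where "0 < d" and
    "\<And>x. x \<in> carrier V \<Longrightarrow> norm_dist V \<zero>\<^bsub>V\<^esub> x < d \<Longrightarrow> norm_dist W (f \<zero>\<^bsub>V\<^esub>) (f x) < 1"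
    using zero_less_one by blast
  then have "\<And>x. x \<in> carrier V \<Longrightarrow> nrm V x < d \<Longrightarrow> nrm W (f x) \<le> 1"
    by (simp add: V.norm_dist_eq W.norm_dist_eq V.M.minus_eq W.M.minus_eq less_imp_le)
  with \<open>0 < d\<close> show "bounded_map V W f"
    unfolding bounded_map_def using bounded_if_bounded_on_ball by blast
next
  assume "bounded_map V W f"
  then obtain K where K: "\<And>x. x \<in> carrier V \<Longrightarrow> nrm W (f x) \<le> K * nrm V x"
    by (auto simp: bounded_map_def)
  \<comment> \<open>\<open>K\<close> may be zero or negative, whereas
    \<open>\<bar>K\<bar> + 1\<close> is a Lipschitz constant by which one can divide.\<close>
  have lip: "norm_dist W (f x) (f y) \<le> (\<bar>K\<bar> + 1) * norm_dist V x y"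
    if "x \<in> carrier V" "y \<in> carrier V" for x y
  proof -
    have "nrm W (f (x \<ominus>\<^bsub>V\<^esub> y)) \<le> K * nrm V (x \<ominus>\<^bsub>V\<^esub> y)"
      using that by (intro K) simp
    also have "\<dots> \<le> (\<bar>K\<bar> + 1) * nrm V (x \<ominus>\<^bsub>V\<^esub> y)"
      using that by (intro mult_right_mono) auto
    finally show ?thesis
      using that by (simp add: V.norm_dist_eq W.norm_dist_eq)
  qed
  show "continuous_map (norm_topology V) (norm_topology W) f"
    unfolding V.norm_topology_eq W.norm_topology_eq
      V.metric.metric_continuous_map[OF W.metric.Metric_space_axioms]
  proof (intro conjI ballI allI impI)
    fix a and e :: real assume a: "a \<in> carrier V" and e: "0 < e"
    have "norm_dist W (f a) (f x) < e"
      if "x \<in> carrier V" "norm_dist V a x < e / (\<bar>K\<bar> + 1)" for x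
    proof -
      have "(\<bar>K\<bar> + 1) * norm_dist V a x < e"
        using that by (simp add: field_simps)
      then show ?thesis
        using lip[OF a that(1)] by linarith
    qed
    then show "\<exists>d>0. \<forall>x. x \<in> carrier V \<and> norm_dist V a x < d \<longrightarrow> norm_dist W (f a) (f x) < e"
      using e by (intro exI[of _ "e / (\<bar>K\<bar> + 1)"]) auto
  qed auto
qed

end

text \<open>The approximate preimages supplied by Baire's theorem (the map \<open>p\<close>) are summed up to an
  exact one.\<close>

lemma bounded_inverse_of_closed_range:
  assumes "banach_space V" "banach_space W" and lin: "linear_map V W f"
    and bdd: "bounded_map V W f" and inj: "inj_on f (carrier V)"
    and closed_range: "closedin (norm_topology W) (f ` carrier V)"
  shows "\<exists>K. \<forall>x\<in>carrier V. nrm V x \<le> K * nrm W (f x)"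
proof -
  interpret V: banach_space V by fact
  interpret W: banach_space W by fact
  interpret f: normed_linear V W f
    by unfold_locales fact
  let ?Y = "f ` carrier V"
  obtain C0 where C0: "\<And>x. x \<in> carrier V \<Longrightarrow> nrm W (f x) \<le> C0 * nrm V x"
    using bdd by (auto simp: bounded_map_def)
  define C where "C = \<bar>C0\<bar>"
  have C: "nrm W (f x) \<le> C * nrm V x" "0 \<le> C" if "x \<in> carrier V" for x
  proof -
    have "C0 * nrm V x \<le> C * nrm V x"
      using that by (intro mult_right_mono) (auto simp: C_def)
    with C0[OF that] show "nrm W (f x) \<le> C * nrm V x"
      by linarith
  qed (simp add: C_def)
  interpret Y: Submetric "carrier W" "norm_dist W" ?Y
    by unfold_locales auto
  have Y_complete: "Y.sub.mcomplete"
    using Y.closedin_eq_mcomplete W.complete closed_range by (simp add: W.norm_topology_eq)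
  \<comment> \<open>The range is complete, being closed in \<open>W\<close>, and the sets
    \<open>D n\<close> cover it because every norm lies below some natural number. By Baire's
    theorem one of them has interior. Closures are taken within the range, not in
    \<open>W\<close>.\<close>
  define D where "D n = Y.sub.mtopology closure_of {f x | x. x \<in> carrier V \<and> nrm V x \<le> real n}"
    for n :: nat
  have D_sub: "{f x | x. x \<in> carrier V \<and> nrm V x \<le> real n} \<subseteq> D n" for n
    unfolding D_def by (intro closure_of_subset) auto
  have "\<exists>n. Y.sub.mtopology interior_of D n \<noteq> {}"
  proof (rule ccontr)
    assume neg: "\<not> ?thesis"
    have "Y.sub.mtopology interior_of \<Union>(range D) = {}"
      using neg Y_complete by (intro Y.sub.metric_Baire_category_alt) (auto simp: D_def)
    moreover have "\<Union>(range D) = ?Y"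
    proof
      show "\<Union>(range D) \<subseteq> ?Y"
        using closure_of_subset_topspace[of Y.sub.mtopology] by (auto simp: D_def)
      show "?Y \<subseteq> \<Union>(range D)"
      proof
        fix y assume "y \<in> ?Y"
        then obtain x where x: "x \<in> carrier V" "y = f x" by auto
        obtain n where "nrm V x \<le> real n" using real_arch_simple by blast
        with x D_sub[of n] show "y \<in> \<Union>(range D)" by auto
      qed
    qed
    ultimately have "?Y = {}"
      using interior_of_topspace[of Y.sub.mtopology] by simp
    then show False
      by blast
  qed
  then obtain n y0 where y0: "y0 \<in> Y.sub.mtopology interior_of D n" by blast
  then obtain U where U: "openin Y.sub.mtopology U" "y0 \<in> U" "U \<subseteq> D n"
    unfolding interior_of_def by blast
  then obtain r where r: "0 < r" "Y.sub.mball y0 r \<subseteq> D n"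
    by (meson Y.sub.openin_mtopology subset_trans)
  have y0Y: "y0 \<in> ?Y"
    using U openin_subset[OF U(1)] by auto
  then have y0W: "y0 \<in> carrier W" by auto
  have approx: "\<exists>x\<in>carrier V. nrm V x \<le> real n \<and> nrm W (z \<ominus>\<^bsub>W\<^esub> f x) < e"
    if z: "z \<in> D n" and e: "0 < e" for z e
  proof -
    have zY: "z \<in> ?Y" "\<exists>y\<in>{f x | x. x \<in> carrier V \<and> nrm V x \<le> real n}. y \<in> Y.sub.mball z e"
      using z e unfolding D_def Y.sub.metric_closure_of by blast+
    then show ?thesis
      by (auto simp: W.norm_dist_eq Y.sub.in_mball)
  qed
  \<comment> \<open>Both \<open>y0 + y\<close> and \<open>y0\<close> lie in \<open>D n\<close>;
    subtracting their approximations moves the ball from \<open>y0\<close> to the origin and doubles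
    the bound to \<open>2 * real n\<close>.\<close>
  have ball: "\<exists>x\<in>carrier V. nrm V x \<le> 2 * real n \<and> nrm W (y \<ominus>\<^bsub>W\<^esub> f x) < e"
    if y: "y \<in> ?Y" "nrm W y < r" and e: "0 < e" for y e
  proof -
    have yW: "y \<in> carrier W" using y by auto
    have "y0 \<oplus>\<^bsub>W\<^esub> y \<in> ?Y"
      using y0Y y by clarsimp (metis V.M.a_closed f.add image_eqI)
    moreover have "norm_dist W y0 (y0 \<oplus>\<^bsub>W\<^esub> y) < r"
    proof -
      have "(y0 \<oplus>\<^bsub>W\<^esub> y) \<ominus>\<^bsub>W\<^esub> y0 = y"
        using y0W yW by (simp add: W.minus_eq_iff W.M.a_comm)
      then show ?thesis
        using y0W yW y W.nrm_minus_commute[of y0 "y0 \<oplus>\<^bsub>W\<^esub> y"] by (simp add: W.norm_dist_eq)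
    qed
    ultimately have "y0 \<oplus>\<^bsub>W\<^esub> y \<in> D n"
      using r y0Y by (auto simp: Y.sub.in_mball)
    then obtain x1 where x1: "x1 \<in> carrier V" "nrm V x1 \<le> real n"
      "nrm W ((y0 \<oplus>\<^bsub>W\<^esub> y) \<ominus>\<^bsub>W\<^esub> f x1) < e / 2"
      using approx[of _ "e / 2"] e by (meson half_gt_zero)
    have "y0 \<in> D n"
      using U by auto
    then obtain x2 where x2: "x2 \<in> carrier V" "nrm V x2 \<le> real n" "nrm W (y0 \<ominus>\<^bsub>W\<^esub> f x2) < e / 2"
      using approx[of _ "e / 2"] e by (meson half_gt_zero)
    have eq: "((y0 \<oplus>\<^bsub>W\<^esub> y) \<ominus>\<^bsub>W\<^esub> f x1) \<ominus>\<^bsub>W\<^esub> (y0 \<ominus>\<^bsub>W\<^esub> f x2) = y \<ominus>\<^bsub>W\<^esub> f (x1 \<ominus>\<^bsub>V\<^esub> x2)"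
    proof -
      have "((y0 \<oplus>\<^bsub>W\<^esub> y) \<ominus>\<^bsub>W\<^esub> f x1) \<ominus>\<^bsub>W\<^esub> (y0 \<ominus>\<^bsub>W\<^esub> f x2)
          = ((y0 \<oplus>\<^bsub>W\<^esub> y) \<ominus>\<^bsub>W\<^esub> y0) \<ominus>\<^bsub>W\<^esub> (f x1 \<ominus>\<^bsub>W\<^esub> f x2)"
        using y0W yW x1 x2 by (intro W.minus_minus_minus) auto
      also have "(y0 \<oplus>\<^bsub>W\<^esub> y) \<ominus>\<^bsub>W\<^esub> y0 = y"
        using y0W yW by (simp add: W.minus_eq_iff W.M.a_comm)
      finally show ?thesis
        using x1 x2 by simp
    qed
    have "nrm W (y \<ominus>\<^bsub>W\<^esub> f (x1 \<ominus>\<^bsub>V\<^esub> x2)) < e"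
      unfolding eq[symmetric]
      using x1 x2 y0W yW
        W.nrm_triangle_minus[of "(y0 \<oplus>\<^bsub>W\<^esub> y) \<ominus>\<^bsub>W\<^esub> f x1" "y0 \<ominus>\<^bsub>W\<^esub> f x2"] by simp
    moreover have "nrm V (x1 \<ominus>\<^bsub>V\<^esub> x2) \<le> 2 * real n"
      using x1 x2 V.nrm_triangle_minus[of x1 x2] by simp
    ultimately show ?thesis
      using x1 x2 by blast
  qed
  \<comment> \<open>A nonzero \<open>y\<close> is scaled by \<open>t = r / (2 * nrm W y)\<close> to
    norm \<open>r / 2\<close>, approximated up to \<open>r / 4\<close> by the image of a vector of
    norm at most \<open>2 * real n\<close>, and scaled back. The inverse of \<open>t\<close> turns
    the error into \<open>nrm W y / 2\<close> and the bound into
    \<open>4 * real n / r * nrm W y\<close>.\<close>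
  define L where "L = 4 * real n / r"
  have L: "0 \<le> L" using r by (simp add: L_def)
  have half: "\<exists>x\<in>carrier V. nrm V x \<le> L * nrm W y \<and> nrm W (y \<ominus>\<^bsub>W\<^esub> f x) \<le> nrm W y / 2"
    if y: "y \<in> ?Y" for y
  proof (cases "y = \<zero>\<^bsub>W\<^esub>")
    case True
    then show ?thesis
      by (intro bexI[of _ "\<zero>\<^bsub>V\<^esub>"]) (auto simp: W.M.minus_eq)
  next
    case False
    have yW: "y \<in> carrier W" using y by auto
    with False have ny: "0 < nrm W y"
      by (metis W.nrm_eq_zero W.nrm_nonneg less_eq_real_def)
    define t where "t = r / (2 * nrm W y)"
    have t: "0 < t" using r ny by (simp add: t_def)
    have "of_real t \<odot>\<^bsub>W\<^esub> y \<in> ?Y"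
      using y by clarsimp (metis V.smult_mem f.smult image_eqI)
    moreover have "nrm W (of_real t \<odot>\<^bsub>W\<^esub> y) < r"
    proof -
      have "t * nrm W y < r"
        using ny r by (simp add: t_def)
      then show ?thesis
        using yW t by simp
    qed
    ultimately obtain x where x: "x \<in> carrier V" "nrm V x \<le> 2 * real n"
      "nrm W (of_real t \<odot>\<^bsub>W\<^esub> y \<ominus>\<^bsub>W\<^esub> f x) < r / 4"
      using ball[of "of_real t \<odot>\<^bsub>W\<^esub> y" "r / 4"] r by auto
    define x' where "x' = of_real (inverse t) \<odot>\<^bsub>V\<^esub> x"
    have x': "x' \<in> carrier V" "nrm V x' \<le> L * nrm W y"
    proof -
      have "inverse t * nrm V x \<le> inverse t * (2 * real n)"
        using x t by (intro mult_left_mono) auto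
      also have "\<dots> = L * nrm W y"
        using r ny by (simp add: t_def L_def)
      finally show "nrm V x' \<le> L * nrm W y"
        using x t by (simp add: x'_def norm_inverse)
    qed (simp add: x'_def x)
    have "y \<ominus>\<^bsub>W\<^esub> f x' = of_real (inverse t) \<odot>\<^bsub>W\<^esub> (of_real t \<odot>\<^bsub>W\<^esub> y \<ominus>\<^bsub>W\<^esub> f x)"
      using x t yW by (simp add: x'_def W.smult_minus flip: of_real_mult)
    then have "nrm W (y \<ominus>\<^bsub>W\<^esub> f x') = inverse t * nrm W (of_real t \<odot>\<^bsub>W\<^esub> y \<ominus>\<^bsub>W\<^esub> f x)"
      using x t yW by (simp add: norm_inverse)
    also have "\<dots> \<le> inverse t * (r / 4)"
      using x t by (intro mult_left_mono) auto
    also have "\<dots> = nrm W y / 2"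
      using r ny by (simp add: t_def field_simps)
    finally show ?thesis
      using x' by blast
  qed
  then obtain p where p: "\<And>y. y \<in> ?Y \<Longrightarrow> p y \<in> carrier V"
    "\<And>y. y \<in> ?Y \<Longrightarrow> nrm V (p y) \<le> L * nrm W y"
    "\<And>y. y \<in> ?Y \<Longrightarrow> nrm W (y \<ominus>\<^bsub>W\<^esub> f (p y)) \<le> nrm W y / 2"
    by metis
  have "nrm V x \<le> 2 * L * nrm W (f x)" if x: "x \<in> carrier V" for x
  proof -
    \<comment> \<open>Each step feeds the residue \<open>f (x - u k)\<close> back into
      \<open>p\<close>, which halves it. The increments are thus at most
      \<open>L * B / 2 ^ k\<close>, a geometric series with sum \<open>2 * L * B\<close>.\<close>
    define u where "u = rec_nat \<zero>\<^bsub>V\<^esub> (\<lambda>_ z. z \<oplus>\<^bsub>V\<^esub> p (f (x \<ominus>\<^bsub>V\<^esub> z)))"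
    define B where "B = nrm W (f x)"
    have B: "0 \<le> B" using x by (simp add: B_def)
    have u_0: "u 0 = \<zero>\<^bsub>V\<^esub>" and
      u_Suc: "u (Suc k) = u k \<oplus>\<^bsub>V\<^esub> p (f (x \<ominus>\<^bsub>V\<^esub> u k))" for k
      by (simp_all add: u_def)
    have u: "u k \<in> carrier V" for k
      by (induction k) (auto simp del: f.minus simp: u_0 u_Suc intro!: V.M.a_closed p(1) x)
    have mem: "f (x \<ominus>\<^bsub>V\<^esub> u k) \<in> ?Y" for k
      using u x by (intro imageI V.M.minus_closed)
    have step: "p (f (x \<ominus>\<^bsub>V\<^esub> u k)) \<in> carrier V" for k
      by (intro p(1) mem)
    have res: "nrm W (f (x \<ominus>\<^bsub>V\<^esub> u k)) \<le> B / 2 ^ k" for k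
    proof (induction k)
      case 0
      then show ?case using x by (simp add: u_0 B_def)
    next
      case (Suc k)
      have "f (x \<ominus>\<^bsub>V\<^esub> u (Suc k)) = f (x \<ominus>\<^bsub>V\<^esub> u k) \<ominus>\<^bsub>W\<^esub> f (p (f (x \<ominus>\<^bsub>V\<^esub> u k)))"
        unfolding u_Suc using u x step by (subst V.minus_add_eq)
          (simp_all del: f.minus add: f.minus[OF _ step])
      then show ?case
        using Suc p(3)[OF mem, of k] by (simp del: f.minus)
    qed
    have "nrm V (u (Suc k) \<ominus>\<^bsub>V\<^esub> u k) \<le> L * B / 2 ^ k" for k
    proof -
      have "u (Suc k) \<ominus>\<^bsub>V\<^esub> u k = p (f (x \<ominus>\<^bsub>V\<^esub> u k))"
        using u step by (simp add: V.minus_eq_iff u_Suc V.M.a_comm)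
      then have "nrm V (u (Suc k) \<ominus>\<^bsub>V\<^esub> u k) \<le> L * nrm W (f (x \<ominus>\<^bsub>V\<^esub> u k))"
        using p(2)[OF mem, of k] by (simp del: f.minus)
      also have "\<dots> \<le> L * (B / 2 ^ k)"
        using res L by (intro mult_left_mono)
      finally show ?thesis by simp
    qed
    note inc = this
    \<comment> \<open>The factor \<open>1 - 1 / 2 ^ m\<close> keeps the finite geometric sum exact;
      the weaker bound \<open>tail'\<close> would not survive the induction on
      \<open>m\<close>.\<close>
    have tail: "nrm V (u (k + m) \<ominus>\<^bsub>V\<^esub> u k) \<le> 2 * L * B / 2 ^ k * (1 - 1 / 2 ^ m)" for k m
    proof (induction m)
      case 0
      then show ?case using u by simp
    next
      case (Suc m)
      have "nrm V (u (k + Suc m) \<ominus>\<^bsub>V\<^esub> u k)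
          \<le> nrm V (u (Suc (k + m)) \<ominus>\<^bsub>V\<^esub> u (k + m)) + nrm V (u (k + m) \<ominus>\<^bsub>V\<^esub> u k)"
        using u V.nrm_triangle[of "u (Suc (k + m)) \<ominus>\<^bsub>V\<^esub> u (k + m)" "u (k + m) \<ominus>\<^bsub>V\<^esub> u k"]
        by (simp add: V.minus_trans)
      also have "\<dots> \<le> L * B / 2 ^ (k + m) + 2 * L * B / 2 ^ k * (1 - 1 / 2 ^ m)"
        using Suc inc by (intro add_mono)
      also have "\<dots> = 2 * L * B / 2 ^ k * (1 - 1 / 2 ^ Suc m)"
        by (simp add: power_add field_simps)
      finally show ?case .
    qed
    have tail': "nrm V (u (k + m) \<ominus>\<^bsub>V\<^esub> u k) \<le> 2 * L * B / 2 ^ k" for k m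
    proof -
      have "2 * L * B / 2 ^ k * (1 - 1 / 2 ^ m) \<le> 2 * L * B / 2 ^ k * 1"
        using L B by (intro mult_left_mono) auto
      with tail[of k m] show ?thesis by linarith
    qed
    have geo: "(\<lambda>k. c / 2 ^ k) \<longlonglongrightarrow> 0" for c :: real
      using tendsto_mult_right_zero[OF LIMSEQ_realpow_zero[of "1 / 2 :: real"], of c]
      by (simp add: power_divide)
    have "\<exists>l\<in>carrier V. (\<lambda>k. nrm V (u k \<ominus>\<^bsub>V\<^esub> l)) \<longlonglongrightarrow> 0"
    proof (rule V.cauchy_convergent[OF u])
      fix e :: real assume "0 < e"
      then have "eventually (\<lambda>k. 2 * L * B / 2 ^ k < e / 2) sequentially"
        using geo by (intro order_tendstoD[of _ 0]) auto
      then obtain N where N: "2 * L * B / 2 ^ N < e / 2"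
        by (auto simp: eventually_sequentially)
      have near: "nrm V (u j \<ominus>\<^bsub>V\<^esub> u N) < e / 2" if "j \<ge> N" for j
        using tail'[of N "j - N"] N that by simp
      have "nrm V (u i \<ominus>\<^bsub>V\<^esub> u j) < e" if "i \<ge> N" "j \<ge> N" for i j
      proof -
        have "nrm V (u i \<ominus>\<^bsub>V\<^esub> u j) \<le> nrm V (u i \<ominus>\<^bsub>V\<^esub> u N) + nrm V (u N \<ominus>\<^bsub>V\<^esub> u j)"
          using u V.nrm_triangle[of "u i \<ominus>\<^bsub>V\<^esub> u N" "u N \<ominus>\<^bsub>V\<^esub> u j"] by (simp add: V.minus_trans)
        then show ?thesis
          using near[OF that(1)] near[OF that(2)] V.nrm_minus_commute[of "u N" "u j"] u by simp
      qed
      then show "\<exists>N. \<forall>m\<ge>N. \<forall>n\<ge>N. nrm V (u m \<ominus>\<^bsub>V\<^esub> u n) < e" by blast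
    qed
    then obtain l where l: "l \<in> carrier V" "(\<lambda>k. nrm V (u k \<ominus>\<^bsub>V\<^esub> l)) \<longlonglongrightarrow> 0" by blast
    \<comment> \<open>The residue at \<open>u k\<close> and the distance from \<open>u k\<close> to
      \<open>l\<close> both tend to zero, so \<open>f\<close> sends \<open>x - l\<close> to zero and
      injectivity gives \<open>x = l\<close>. The bound on the partial sums then passes to
      \<open>x\<close>.\<close>
    have "nrm W (f (x \<ominus>\<^bsub>V\<^esub> l)) \<le> B / 2 ^ k + C * nrm V (u k \<ominus>\<^bsub>V\<^esub> l)" for k
    proof -
      have "nrm W (f (x \<ominus>\<^bsub>V\<^esub> l)) \<le> nrm W (f (x \<ominus>\<^bsub>V\<^esub> u k)) + nrm W (f (u k \<ominus>\<^bsub>V\<^esub> l))"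
        using W.nrm_triangle[of "f (x \<ominus>\<^bsub>V\<^esub> u k)" "f (u k \<ominus>\<^bsub>V\<^esub> l)"] u x l
        by (simp add: W.minus_trans)
      also have "\<dots> \<le> B / 2 ^ k + C * nrm V (u k \<ominus>\<^bsub>V\<^esub> l)"
        using u l by (intro add_mono res C) auto
      finally show ?thesis .
    qed
    moreover have "(\<lambda>k. B / 2 ^ k + C * nrm V (u k \<ominus>\<^bsub>V\<^esub> l)) \<longlonglongrightarrow> 0 + C * 0"
      using geo l(2) by (intro tendsto_intros)
    ultimately have "nrm W (f (x \<ominus>\<^bsub>V\<^esub> l)) \<le> 0"
      by (intro LIMSEQ_le_const[of _ 0]) auto
    then have "f (x \<ominus>\<^bsub>V\<^esub> l) = \<zero>\<^bsub>W\<^esub>"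
      using W.nrm_le_zero[of "f (x \<ominus>\<^bsub>V\<^esub> l)"] x l by simp
    then have "x = l"
      using inj x l by (simp add: W.minus_eq_zero_iff inj_on_eq_iff)
    have "nrm V x \<le> 2 * L * B + nrm V (u k \<ominus>\<^bsub>V\<^esub> x)" for k
    proof -
      have "nrm V x \<le> nrm V (x \<ominus>\<^bsub>V\<^esub> u k) + nrm V (u k)"
        using x u by (intro V.nrm_le_add_minus)
      moreover have "nrm V (u k) \<le> 2 * L * B"
        using tail'[of 0 k] u by (simp add: u_0)
      ultimately show ?thesis
        using V.nrm_minus_commute[of x "u k"] x u by simp
    qed
    moreover have "(\<lambda>k. 2 * L * B + nrm V (u k \<ominus>\<^bsub>V\<^esub> x)) \<longlonglongrightarrow> 2 * L * B + 0"
      using l(2) unfolding \<open>x = l\<close>[symmetric] by (intro tendsto_intros)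
    ultimately have "nrm V x \<le> 2 * L * B + 0"
      by (intro LIMSEQ_le_const[of _ "2 * L * B + 0"]) auto
    then show ?thesis by (simp add: B_def)
  qed
  then show ?thesis by blast
qed

section \<open>Compact bilinear maps and cocycles\<close>

text \<open>This is the cancellation behind the cocycle identity for the defect of a section
  \<open>Q\<close>: \<open>x\<close>, \<open>y\<close>, \<open>z\<close>, \<open>w\<close> stand for
  \<open>Q a Q b Q c\<close>, \<open>Q a Q (b c)\<close>, \<open>Q (a b) Q c\<close> and
  \<open>Q (a b c)\<close>.\<close>

lemma (in normed_module) four_term_cancel:
  assumes "x \<in> carrier V" "y \<in> carrier V" "z \<in> carrier V" "w \<in> carrier V"
  shows "(x \<ominus>\<^bsub>V\<^esub> y) \<ominus>\<^bsub>V\<^esub> (z \<ominus>\<^bsub>V\<^esub> w) \<oplus>\<^bsub>V\<^esub> (y \<ominus>\<^bsub>V\<^esub> w) \<ominus>\<^bsub>V\<^esub> (x \<ominus>\<^bsub>V\<^esub> z) = \<zero>\<^bsub>V\<^esub>"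
proof -
  have "(x \<ominus>\<^bsub>V\<^esub> y) \<ominus>\<^bsub>V\<^esub> (z \<ominus>\<^bsub>V\<^esub> w) \<oplus>\<^bsub>V\<^esub> (y \<ominus>\<^bsub>V\<^esub> w) = x \<ominus>\<^bsub>V\<^esub> z"
    using assms by (simp add: minus_minus_minus[of x y z w] minus_add_cancel)
  then show ?thesis
    using assms by simp
qed

section \<open>Bilinear maps\<close>

locale normed_bilinear = U: normed_module U + V: normed_module V + W: normed_module W
  for U :: "('k::{real_normed_field, banach}, 'u, 'x) normed_space_scheme"
    and V :: "('k, 'v, 'y) normed_space_scheme"
    and W :: "('k, 'w, 'z) normed_space_scheme"
    and T :: "'u \<Rightarrow> 'v \<Rightarrow> 'w" +
  assumes bilinear: "bilinear_map U V W T"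
begin

lemma normed_linear_left: "y \<in> carrier V \<Longrightarrow> normed_linear U W (\<lambda>x. T x y)"
  using bilinear by unfold_locales (simp add: bilinear_map_def)

lemma normed_linear_right: "x \<in> carrier U \<Longrightarrow> normed_linear V W (T x)"
  using bilinear by unfold_locales (simp add: bilinear_map_def)

lemmas closed [simp, intro] = normed_linear.closed[OF normed_linear_right]
lemmas add_left [simp] = normed_linear.add[OF normed_linear_left]
lemmas add_right [simp] = normed_linear.add[OF normed_linear_right]
lemmas smult_left [simp] = normed_linear.smult[OF normed_linear_left]
lemmas smult_right [simp] = normed_linear.smult[OF normed_linear_right]
lemmas uminus_left [simp] = normed_linear.uminus[OF normed_linear_left]
lemmas uminus_right [simp] = normed_linear.uminus[OF normed_linear_right]
lemmas minus_left [simp] = normed_linear.minus[OF normed_linear_left]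
lemmas minus_right [simp] = normed_linear.minus[OF normed_linear_right]
lemmas zero_left [simp] = normed_linear.zero[OF normed_linear_left]
lemmas zero_right [simp] = normed_linear.zero[OF normed_linear_right]

end

lemma linear_mapI:
  assumes "\<And>x. x \<in> carrier V \<Longrightarrow> f x \<in> carrier W"
    and "\<And>x y. x \<in> carrier V \<Longrightarrow> y \<in> carrier V \<Longrightarrow> f (x \<oplus>\<^bsub>V\<^esub> y) = f x \<oplus>\<^bsub>W\<^esub> f y"
    and "\<And>c x. x \<in> carrier V \<Longrightarrow> f (c \<odot>\<^bsub>V\<^esub> x) = c \<odot>\<^bsub>W\<^esub> f x"
  shows "linear_map V W f"
  using assms by (auto simp: linear_map_def)

lemma bilinear_mapI:
  assumes "\<And>x y. x \<in> carrier U \<Longrightarrow> y \<in> carrier V \<Longrightarrow> T x y \<in> carrier W"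
    and "\<And>x x' y. x \<in> carrier U \<Longrightarrow> x' \<in> carrier U \<Longrightarrow> y \<in> carrier V \<Longrightarrow>
      T (x \<oplus>\<^bsub>U\<^esub> x') y = T x y \<oplus>\<^bsub>W\<^esub> T x' y"
    and "\<And>x y y'. x \<in> carrier U \<Longrightarrow> y \<in> carrier V \<Longrightarrow> y' \<in> carrier V \<Longrightarrow>
      T x (y \<oplus>\<^bsub>V\<^esub> y') = T x y \<oplus>\<^bsub>W\<^esub> T x y'"
    and "\<And>c x y. x \<in> carrier U \<Longrightarrow> y \<in> carrier V \<Longrightarrow> T (c \<odot>\<^bsub>U\<^esub> x) y = c \<odot>\<^bsub>W\<^esub> T x y"
    and "\<And>c x y. x \<in> carrier U \<Longrightarrow> y \<in> carrier V \<Longrightarrow> T x (c \<odot>\<^bsub>V\<^esub> y) = c \<odot>\<^bsub>W\<^esub> T x y"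
  shows "bilinear_map U V W T"
  unfolding bilinear_map_def by (intro conjI ballI linear_mapI assms)

section \<open>Compactness as total boundedness\<close>

text \<open>Total boundedness means that every sequence has a Cauchy subsequence. One is extracted
  for \<open>u\<close>, a further one from it for \<open>v\<close>, and along the result the
  estimate makes \<open>w\<close> Cauchy. Indexing all three families by \<open>P\<close> avoids
  having to write \<open>w\<close> as a function of the values of \<open>u\<close> and
  \<open>v\<close>; two dominating families are there for the sake of differences of compact
  maps.\<close>

lemma mtotally_bounded_image_dominated:
  assumes "Metric_space M1 d1" "Metric_space M2 d2" "Metric_space M d"
    and u: "Metric_space.mtotally_bounded M1 d1 (u ` P)"
    and v: "Metric_space.mtotally_bounded M2 d2 (v ` P)"
    and w: "w ` P \<subseteq> M"
    and le: "\<And>p p'. p \<in> P \<Longrightarrow> p' \<in> P \<Longrightarrow> d (w p) (w p') \<le> K * (d1 (u p) (u p') + d2 (v p) (v p'))"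
  shows "Metric_space.mtotally_bounded M d (w ` P)"
proof -
  interpret M1: Metric_space M1 d1 by fact
  interpret M2: Metric_space M2 d2 by fact
  interpret M: Metric_space M d by fact
  show ?thesis
    unfolding M.mtotally_bounded_sequentially
  proof (intro conjI allI impI w)
    fix \<sigma> :: "nat \<Rightarrow> _" assume "range \<sigma> \<subseteq> w ` P"
    then have "\<forall>n. \<exists>p\<in>P. \<sigma> n = w p" by blast
    then obtain p where p: "\<And>n. p n \<in> P" "\<And>n. \<sigma> n = w (p n)"
      by metis
    obtain r where r: "strict_mono r" "M1.MCauchy ((\<lambda>n. u (p n)) \<circ> r)"
      using u p(1) unfolding M1.mtotally_bounded_sequentially by (metis image_subsetI image_eqI)
    obtain s where s: "strict_mono s" "M2.MCauchy ((\<lambda>n. v (p (r n))) \<circ> s)"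
      using v p(1) unfolding M2.mtotally_bounded_sequentially by (metis image_subsetI image_eqI)
    have rs: "strict_mono (r \<circ> s)"
      using r(1) s(1) by (rule strict_mono_o)
    have "M.MCauchy (\<sigma> \<circ> (r \<circ> s))"
      unfolding M.MCauchy_def
    proof (intro conjI allI impI)
      show "range (\<sigma> \<circ> (r \<circ> s)) \<subseteq> M"
        using w p by auto
      fix e :: real assume e: "0 < e"
      define L where "L = \<bar>K\<bar> + 1"
      have L: "0 < L" "K \<le> L" by (auto simp: L_def)
      have e': "0 < e / (2 * L)"
        using e L by simp
      obtain N1 where N1: "\<And>n n'. N1 \<le> n \<Longrightarrow> N1 \<le> n' \<Longrightarrow> d1 (u (p (r n))) (u (p (r n'))) < e / (2 * L)"
        using r(2) e' unfolding M1.MCauchy_def comp_def by meson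
      obtain N2 where N2: "\<And>n n'. N2 \<le> n \<Longrightarrow> N2 \<le> n' \<Longrightarrow>
          d2 (v (p (r (s n)))) (v (p (r (s n')))) < e / (2 * L)"
        using s(2) e' unfolding M2.MCauchy_def comp_def by meson
      have "d ((\<sigma> \<circ> (r \<circ> s)) n) ((\<sigma> \<circ> (r \<circ> s)) n') < e" if "max N1 N2 \<le> n" "max N1 N2 \<le> n'" for n n'
      proof -
        \<comment> \<open>\<open>N1\<close> was chosen for the subsequence \<open>r\<close> before
          it was thinned out by \<open>s\<close>; since \<open>s n\<close> is at least
          \<open>n\<close>, it still applies at \<open>s n\<close>.\<close>
        have ge: "N1 \<le> s n" "N1 \<le> s n'"
          using that strict_mono_imp_increasing[OF s(1)] by (meson le_trans max.boundedE)+
        let ?q = "p (r (s n))" and ?q' = "p (r (s n'))"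
        have "d (w ?q) (w ?q') \<le> K * (d1 (u ?q) (u ?q') + d2 (v ?q) (v ?q'))"
          by (intro le p)
        also have "\<dots> \<le> L * (d1 (u ?q) (u ?q') + d2 (v ?q) (v ?q'))"
          using L by (intro mult_right_mono) auto
        also have "\<dots> < L * (e / (2 * L) + e / (2 * L))"
          using L ge that by (intro mult_strict_left_mono add_strict_mono N1 N2) auto
        also have "\<dots> = e"
          using L by (simp add: field_simps)
        finally show ?thesis
          by (simp add: p)
      qed
      then show "\<exists>N. \<forall>n n'. N \<le> n \<longrightarrow> N \<le> n' \<longrightarrow> d ((\<sigma> \<circ> (r \<circ> s)) n) ((\<sigma> \<circ> (r \<circ> s)) n') < e"
        by blast
    qed
    with rs show "\<exists>r. strict_mono r \<and> M.MCauchy (\<sigma> \<circ> r)" by blast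
  qed
qed

definition unit_balls ::
  "('k, 'u, 'x) normed_space_scheme \<Rightarrow> ('k, 'v, 'y) normed_space_scheme \<Rightarrow> ('u \<times> 'v) set" where
  "unit_balls U V = {x \<in> carrier U. nrm U x < 1} \<times> {y \<in> carrier V. nrm V y < 1}"

text \<open>In a complete space a set has compact closure exactly if it is totally bounded; the
  closure disappears from the condition.\<close>

lemma compact_bilinear_map_iff:
  assumes "banach_space W"
  shows "compact_bilinear_map U V W T \<longleftrightarrow> bilinear_map U V W T \<and>
    Metric_space.mtotally_bounded (carrier W) (norm_dist W) ((\<lambda>(x, y). T x y) ` unit_balls U V)"
proof -
  interpret W: banach_space W by fact
  have eq: "{T x y | x y. x \<in> carrier U \<and> y \<in> carrier V \<and> nrm U x < 1 \<and> nrm V y < 1}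
      = (\<lambda>(x, y). T x y) ` unit_balls U V"
    by (auto simp: unit_balls_def)
  have "(\<lambda>(x, y). T x y) ` unit_balls U V \<subseteq> carrier W" if "bilinear_map U V W T"
    using that by (auto simp: bilinear_map_def linear_map_def unit_balls_def)
  then show ?thesis
    unfolding compact_bilinear_map_def eq W.norm_topology_eq
    using W.metric.mtotally_bounded_eq_compact_closure_of[OF W.complete] by blast
qed

text \<open>The one criterion behind every transfer of compactness here: to differences, from
  \<open>B\<close> down to \<open>E\<close>, and from \<open>E\<close> up to the twisted product.
  Where a single map dominates, it fills both slots and the constant is halved.\<close>

lemma compact_bilinear_map_dominated:
  assumes "banach_space W1" "banach_space W2" "banach_space W"
    and T1: "compact_bilinear_map U V W1 T1" and T2: "compact_bilinear_map U V W2 T2"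
    and T: "bilinear_map U V W T"
    and le: "\<And>x y x' y'. \<lbrakk>x \<in> carrier U; x' \<in> carrier U; y \<in> carrier V; y' \<in> carrier V\<rbrakk> \<Longrightarrow>
      nrm W (T x y \<ominus>\<^bsub>W\<^esub> T x' y') \<le>
        K * (nrm W1 (T1 x y \<ominus>\<^bsub>W1\<^esub> T1 x' y') + nrm W2 (T2 x y \<ominus>\<^bsub>W2\<^esub> T2 x' y'))"
  shows "compact_bilinear_map U V W T"
proof -
  interpret W1: banach_space W1 by fact
  interpret W2: banach_space W2 by fact
  interpret W: banach_space W by fact
  have mem: "T1 x y \<in> carrier W1" "T2 x y \<in> carrier W2" "T x y \<in> carrier W"
    if "x \<in> carrier U" "y \<in> carrier V" for x y
    using T1 T2 T that by (auto simp: compact_bilinear_map_def bilinear_map_def linear_map_def)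
  have "W.metric.mtotally_bounded ((\<lambda>(x, y). T x y) ` unit_balls U V)"
  proof (rule mtotally_bounded_image_dominated[OF W1.metric.Metric_space_axioms
        W2.metric.Metric_space_axioms W.metric.Metric_space_axioms])
    show "W1.metric.mtotally_bounded ((\<lambda>(x, y). T1 x y) ` unit_balls U V)"
      using T1 compact_bilinear_map_iff[OF assms(1)] by blast
    show "W2.metric.mtotally_bounded ((\<lambda>(x, y). T2 x y) ` unit_balls U V)"
      using T2 compact_bilinear_map_iff[OF assms(2)] by blast
    show "(\<lambda>(x, y). T x y) ` unit_balls U V \<subseteq> carrier W"
      using mem by (auto simp: unit_balls_def)
    show "norm_dist W (case p of (x, y) \<Rightarrow> T x y) (case p' of (x, y) \<Rightarrow> T x y) \<le>
        K * (norm_dist W1 (case p of (x, y) \<Rightarrow> T1 x y) (case p' of (x, y) \<Rightarrow> T1 x y) +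
             norm_dist W2 (case p of (x, y) \<Rightarrow> T2 x y) (case p' of (x, y) \<Rightarrow> T2 x y))"
      if "p \<in> unit_balls U V" "p' \<in> unit_balls U V" for p p'
      using that le mem
      by (auto simp: unit_balls_def W.norm_dist_eq W1.norm_dist_eq W2.norm_dist_eq split: prod.splits)
  qed
  with T show ?thesis
    by (simp add: compact_bilinear_map_iff[OF assms(3)])
qed

lemma compact_bilinear_map_zero:
  assumes "normed_module U" "normed_module V" "banach_space W"
  shows "compact_bilinear_map U V W (\<lambda>x y. \<zero>\<^bsub>W\<^esub>)"
proof -
  interpret W: banach_space W by fact
  interpret U: normed_module U by fact
  interpret V: normed_module V by fact
  have "unit_balls U V \<noteq> {}"
    by (auto simp: unit_balls_def intro!: exI[of _ "\<zero>\<^bsub>U\<^esub>"] exI[of _ "\<zero>\<^bsub>V\<^esub>"])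
  then have "(\<lambda>(x, y). \<zero>\<^bsub>W\<^esub>) ` unit_balls U V = {\<zero>\<^bsub>W\<^esub>}"
    by auto
  then show ?thesis
    by (simp add: compact_bilinear_map_iff[OF assms(3)] bilinear_mapI)
qed

lemma compact_bilinear_map_minus:
  assumes "normed_module U" "normed_module V" "banach_space W"
    and T: "compact_bilinear_map U V W T" and T': "compact_bilinear_map U V W T'"
  shows "compact_bilinear_map U V W (\<lambda>x y. T x y \<ominus>\<^bsub>W\<^esub> T' x y)"
proof -
  interpret W: banach_space W by fact
  interpret U: normed_module U by fact
  interpret V: normed_module V by fact
  interpret T: normed_bilinear U V W T
    using T by unfold_locales (simp add: compact_bilinear_map_def)
  interpret T': normed_bilinear U V W T'
    using T' by unfold_locales (simp add: compact_bilinear_map_def)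
  show ?thesis
  proof (rule compact_bilinear_map_dominated[OF assms(3) assms(3) assms(3) T T', where K = 1])
    show "bilinear_map U V W (\<lambda>x y. T x y \<ominus>\<^bsub>W\<^esub> T' x y)"
      by (rule bilinear_mapI) (auto simp: W.smult_minus W.add_minus_add)
    show "nrm W (T x y \<ominus>\<^bsub>W\<^esub> T' x y \<ominus>\<^bsub>W\<^esub> (T x' y' \<ominus>\<^bsub>W\<^esub> T' x' y')) \<le>
        1 * (nrm W (T x y \<ominus>\<^bsub>W\<^esub> T x' y') + nrm W (T' x y \<ominus>\<^bsub>W\<^esub> T' x' y'))"
      if "x \<in> carrier U" "x' \<in> carrier U" "y \<in> carrier V" "y' \<in> carrier V" for x y x' y'
      using that W.nrm_triangle_minus[of "T x y \<ominus>\<^bsub>W\<^esub> T x' y'" "T' x y \<ominus>\<^bsub>W\<^esub> T' x' y'"]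
      by (simp add: W.minus_minus_minus)
  qed
qed

text \<open>A totally bounded set is bounded, and homogeneity in each variable separately spreads
  the bound from the unit balls to the whole spaces; each of the two scalings contributes a factor
  2. This is what makes the product twisted by a compact cocycle continuous.\<close>

lemma compact_bilinear_map_bounded:
  assumes "normed_module U" "normed_module V" "banach_space W"
    and T: "compact_bilinear_map U V W T"
  obtains C where "0 \<le> C"
    and "\<And>x y. x \<in> carrier U \<Longrightarrow> y \<in> carrier V \<Longrightarrow> nrm W (T x y) \<le> C * nrm U x * nrm V y"
proof -
  interpret W: banach_space W by fact
  interpret U: normed_module U by fact
  interpret V: normed_module V by fact
  interpret T: normed_bilinear U V W T
    using T by unfold_locales (simp add: compact_bilinear_map_def)
  have "W.metric.mbounded ((\<lambda>(x, y). T x y) ` unit_balls U V)"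
    using T compact_bilinear_map_iff[OF assms(3)] W.metric.mtotally_bounded_imp_mbounded by blast
  then obtain w b where w: "(\<lambda>(x, y). T x y) ` unit_balls U V \<subseteq> W.metric.mcball w b"
    by (auto simp: W.metric.mbounded_def)
  \<comment> \<open>The bounded set lies in a ball with arbitrary centre \<open>w\<close>, hence the
    summand \<open>nrm W w\<close>; the absolute value makes \<open>c\<close> nonnegative in every
    case.\<close>
  define c where "c = \<bar>b + nrm W w\<bar>"
  have unit: "nrm W (T x y) \<le> c"
    if "x \<in> carrier U" "nrm U x < 1" "y \<in> carrier V" "nrm V y < 1" for x y
  proof -
    have "T x y \<in> W.metric.mcball w b"
      using w that by (force simp: unit_balls_def)
    then have *: "w \<in> carrier W" "nrm W (w \<ominus>\<^bsub>W\<^esub> T x y) \<le> b"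
      using that by (auto simp: W.norm_dist_eq)
    show ?thesis
      using W.nrm_le_add_minus[of "T x y" w] W.nrm_minus_commute[of "T x y" w] * that
      by (simp add: c_def)
  qed
  show thesis
  proof (rule that)
    show "0 \<le> 4 * c" by (simp add: c_def)
    fix x y assume x: "x \<in> carrier U" and y: "y \<in> carrier V"
    have half: "nrm W (T x' y) \<le> 2 * c * nrm V y" if "x' \<in> carrier U" "nrm U x' < 1" for x'
      using normed_linear.bounded_if_bounded_on_ball[OF T.normed_linear_right[OF that(1)], of 1 c y]
        unit that y by simp
    have "nrm W (T x y) \<le> 2 * (2 * c * nrm V y) / 1 * nrm U x"
      by (rule normed_linear.bounded_if_bounded_on_ball[OF T.normed_linear_left[OF y]])
        (use half x in auto)
    then show "nrm W (T x y) \<le> 4 * c * nrm U x * nrm V y"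
      by (simp add: mult_ac)
  qed
qed

sublocale banach_algebra \<subseteq> mult: normed_bilinear A A A "monoid.mult A"
  by unfold_locales (rule mult_bilinear)

sublocale banach_bimodule \<subseteq> lact: normed_bilinear A E E "lact E"
  by unfold_locales (rule lact_bilinear)

sublocale banach_bimodule \<subseteq> ract: normed_bilinear E A E "ract E"
  by unfold_locales (rule ract_bilinear)

section \<open>Vanishing of the cohomology quotients\<close>

text \<open>The cochains are total functions whose values off the carriers are arbitrary, so they
  form no group and \<open>T - T\<close> need not be the zero function. The subspace properties
  therefore enter as hypotheses; the last one undoes the sign, since congruence to zero only yields
  \<open>0 - T\<close>.\<close>

lemma quotient_trivial_iff:
  assumes zero: "(\<lambda>a b. \<zero>\<^bsub>E\<^esub>) \<in> Z"
    and diff: "\<And>T T'. T \<in> Z \<Longrightarrow> T' \<in> Z \<Longrightarrow> (\<lambda>a b. T a b \<ominus>\<^bsub>E\<^esub> T' a b) \<in> Z"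
    and refl: "\<And>T. T \<in> Z \<Longrightarrow> (\<lambda>a b. T a b \<ominus>\<^bsub>E\<^esub> T a b) \<in> N"
    and neg: "\<And>T. T \<in> Z \<Longrightarrow> (\<lambda>a b. \<zero>\<^bsub>E\<^esub> \<ominus>\<^bsub>E\<^esub> T a b) \<in> N \<Longrightarrow> T \<in> N"
  shows "Z // cong_mod E Z N = {zero_coset E Z N} \<longleftrightarrow> Z \<subseteq> N"
proof
  assume eq: "Z // cong_mod E Z N = {zero_coset E Z N}"
  show "Z \<subseteq> N"
  proof
    fix T assume T: "T \<in> Z"
    then have "cong_mod E Z N `` {T} = zero_coset E Z N"
      using eq quotientI[OF T, of "cong_mod E Z N"] by auto
    moreover have "T \<in> cong_mod E Z N `` {T}"
      using T refl by (auto simp: cong_mod_def)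
    ultimately have "(\<lambda>a b. \<zero>\<^bsub>E\<^esub> \<ominus>\<^bsub>E\<^esub> T a b) \<in> N"
      by (auto simp: zero_coset_def cong_mod_def)
    with T show "T \<in> N" by (rule neg)
  qed
next
  assume "Z \<subseteq> N"
  \<comment> \<open>Once \<open>Z\<close> lies in \<open>N\<close>, any two elements of
    \<open>Z\<close> are congruent, so every class is all of \<open>Z\<close>. The quotient is then
    \<open>{Z}\<close>, which needs \<open>Z\<close> to be nonempty.\<close>
  then have *: "cong_mod E Z N `` {T} = Z" if "T \<in> Z" for T
    using diff that by (auto simp: cong_mod_def)
  have "Z // cong_mod E Z N = (\<Union>T\<in>Z. {Z})"
    unfolding quotient_def using * by simp
  also have "\<dots> = {Z}"
    using zero by auto
  finally show "Z // cong_mod E Z N = {zero_coset E Z N}"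
    using * zero by (simp add: zero_coset_def)
qed

context banach_bimodule
begin

lemma delta1_uminus:
  assumes "linear_map A E S" "a \<in> carrier A" "b \<in> carrier A"
  shows "delta1 A E (\<lambda>a. \<ominus>\<^bsub>E\<^esub> S a) a b = \<ominus>\<^bsub>E\<^esub> delta1 A E S a b"
proof -
  interpret S: normed_linear A E S by unfold_locales fact
  show ?thesis
    using assms by (simp add: delta1_def E.M.minus_eq E.M.minus_add)
qed

lemma linear_map_uminus: "linear_map A E S \<Longrightarrow> linear_map A E (\<lambda>a. \<ominus>\<^bsub>E\<^esub> S a)"
  by (rule linear_mapI) (auto simp: linear_map_def E.M.minus_add E.smult_r_minus Pi_iff)

lemma bounded_map_uminus:
  "linear_map A E S \<Longrightarrow> bounded_map A E S \<Longrightarrow> bounded_map A E (\<lambda>a. \<ominus>\<^bsub>E\<^esub> S a)"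
  by (auto simp: bounded_map_def linear_map_def Pi_iff)

lemma Z2K_minus:
  assumes "T \<in> Z2K A E" "T' \<in> Z2K A E"
  shows "(\<lambda>a b. T a b \<ominus>\<^bsub>E\<^esub> T' a b) \<in> Z2K A E"
proof -
  have T: "compact_bilinear_map A A E T" and T': "compact_bilinear_map A A E T'"
    using assms by (auto simp: Z2K_def)
  interpret T: normed_bilinear A A E T
    using T by unfold_locales (simp add: compact_bilinear_map_def)
  interpret T': normed_bilinear A A E T'
    using T' by unfold_locales (simp add: compact_bilinear_map_def)
  have "delta2 A E (\<lambda>a b. T a b \<ominus>\<^bsub>E\<^esub> T' a b) a b c = delta2 A E T a b c \<ominus>\<^bsub>E\<^esub> delta2 A E T' a b c"
    if "a \<in> carrier A" "b \<in> carrier A" "c \<in> carrier A" for a b c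
    using that by (simp add: delta2_def E.M.minus_eq E.M.minus_add E.M.a_ac)
  with assms show ?thesis
    using compact_bilinear_map_minus[OF A.normed_module_axioms A.normed_module_axioms
        E.banach_space_axioms T T']
    by (auto simp: Z2K_def)
qed

lemma zero_in_Z2K: "(\<lambda>a b. \<zero>\<^bsub>E\<^esub>) \<in> Z2K A E"
  using compact_bilinear_map_zero[OF A.normed_module_axioms A.normed_module_axioms
      E.banach_space_axioms]
  by (auto simp: Z2K_def delta2_def)

text \<open>The predicate \<open>P\<close> is \<open>bounded_map A E\<close> for \<open>H2K\<close> and trivially true for \<open>H2K_tilde\<close>.\<close>

lemma cohomology_trivial_iff:
  assumes N: "N = {T. compact_bilinear_map A A E T \<and>
      (\<exists>S. linear_map A E S \<and> P S \<and>
        (\<forall>a\<in>carrier A. \<forall>b\<in>carrier A. T a b = delta1 A E S a b))}"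
    and P_zero: "P (\<lambda>a. \<zero>\<^bsub>E\<^esub>)"
    and P_uminus: "\<And>S. linear_map A E S \<Longrightarrow> P S \<Longrightarrow> P (\<lambda>a. \<ominus>\<^bsub>E\<^esub> S a)"
  shows "Z2K A E // cong_mod E (Z2K A E) N = {zero_coset E (Z2K A E) N} \<longleftrightarrow>
    (\<forall>T\<in>Z2K A E. \<exists>S. linear_map A E S \<and> P S \<and>
      (\<forall>a\<in>carrier A. \<forall>b\<in>carrier A. T a b = delta1 A E S a b))"
proof -
  have mem: "T a b \<in> carrier E" if "T \<in> Z2K A E" "a \<in> carrier A" "b \<in> carrier A" for T a b
    using that by (auto simp: Z2K_def compact_bilinear_map_def bilinear_map_def linear_map_def)
  have "Z2K A E // cong_mod E (Z2K A E) N = {zero_coset E (Z2K A E) N} \<longleftrightarrow> Z2K A E \<subseteq> N"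
  proof (rule quotient_trivial_iff)
    fix T assume T: "T \<in> Z2K A E"
    have "compact_bilinear_map A A E (\<lambda>a b. T a b \<ominus>\<^bsub>E\<^esub> T a b)"
      using Z2K_minus[OF T T] by (simp add: Z2K_def)
    moreover have "linear_map A E (\<lambda>a. \<zero>\<^bsub>E\<^esub>)"
      by (rule linear_mapI) auto
    ultimately show "(\<lambda>a b. T a b \<ominus>\<^bsub>E\<^esub> T a b) \<in> N"
      using P_zero mem[OF T] by (auto simp: N delta1_def intro!: exI[of _ "\<lambda>a. \<zero>\<^bsub>E\<^esub>"])
    assume "(\<lambda>a b. \<zero>\<^bsub>E\<^esub> \<ominus>\<^bsub>E\<^esub> T a b) \<in> N"
    then obtain S where S: "linear_map A E S" "P S"
      "\<And>a b. a \<in> carrier A \<Longrightarrow> b \<in> carrier A \<Longrightarrow> \<zero>\<^bsub>E\<^esub> \<ominus>\<^bsub>E\<^esub> T a b = delta1 A E S a b"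
      by (auto simp: N)
    \<comment> \<open>Congruence to zero presents \<open>0 - T\<close> as a coboundary of
      \<open>S\<close>, so the primitive of \<open>T\<close> is \<open>- S\<close>.\<close>
    have "T a b = delta1 A E (\<lambda>a. \<ominus>\<^bsub>E\<^esub> S a) a b" if "a \<in> carrier A" "b \<in> carrier A" for a b
      using S(3)[OF that, symmetric] mem[OF T that] that by (simp add: delta1_uminus S(1) E.M.minus_eq)
    moreover have "compact_bilinear_map A A E T"
      using T by (simp add: Z2K_def)
    ultimately show "T \<in> N"
      using S P_uminus linear_map_uminus unfolding N by blast
  qed (use Z2K_minus zero_in_Z2K in auto)
  also have "\<dots> \<longleftrightarrow> (\<forall>T\<in>Z2K A E. \<exists>S. linear_map A E S \<and> P S \<and>
      (\<forall>a\<in>carrier A. \<forall>b\<in>carrier A. T a b = delta1 A E S a b))"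
    by (auto simp: N Z2K_def)
  finally show ?thesis .
qed

lemma H2K_trivial_iff:
  "H2K A E = {zero_coset E (Z2K A E) (N2K A E)} \<longleftrightarrow>
    (\<forall>T\<in>Z2K A E. \<exists>S. linear_map A E S \<and> bounded_map A E S \<and>
      (\<forall>a\<in>carrier A. \<forall>b\<in>carrier A. T a b = delta1 A E S a b))"
  unfolding H2K_def
proof (rule cohomology_trivial_iff)
  show "bounded_map A E (\<lambda>a. \<zero>\<^bsub>E\<^esub>)"
    by (auto simp: bounded_map_def intro: exI[of _ 0])
qed (auto simp: N2K_def bounded_map_uminus)

lemma H2K_tilde_trivial_iff:
  "H2K_tilde A E = {zero_coset E (Z2K A E) (N2K_tilde A E)} \<longleftrightarrow>
    (\<forall>T\<in>Z2K A E. \<exists>S. linear_map A E S \<and>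
      (\<forall>a\<in>carrier A. \<forall>b\<in>carrier A. T a b = delta1 A E S a b))"
  unfolding H2K_tilde_def
  using cohomology_trivial_iff[of "N2K_tilde A E" "\<lambda>_. True"] by (simp add: N2K_tilde_def)

end

section \<open>From extensions to cocycles\<close>

text \<open>The additive inverse is a definite description over the carrier, so shrinking the
  carrier changes the term. Multiplication by \<open>-1\<close> refers to no carrier and identifies
  the two inverses.\<close>

lemma minus_carrier_update:
  assumes "normed_module B" "normed_module (B\<lparr>carrier := H\<rparr>)" "H \<subseteq> carrier B" "x \<in> H" "y \<in> H"
  shows "x \<ominus>\<^bsub>B\<lparr>carrier := H\<rparr>\<^esub> y = x \<ominus>\<^bsub>B\<^esub> y"
proof -
  interpret B: normed_module B by fact
  interpret H: normed_module "B\<lparr>carrier := H\<rparr>" by fact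
  have "\<ominus>\<^bsub>B\<lparr>carrier := H\<rparr>\<^esub> y = \<ominus>\<^bsub>B\<^esub> y"
    using H.uminus_eq_smult[of y] B.uminus_eq_smult[of y] assms by auto
  then show ?thesis
    by (simp add: a_minus_def)
qed

text \<open>A Cauchy sequence in \<open>H\<close> converges in \<open>B\<close>, and closedness
  keeps the limit in \<open>H\<close>. An extension must have a Banach algebra as its kernel, and
  this supplies it for the twisted product.\<close>

lemma closed_ideal_banach_algebra:
  fixes B :: "('k::{real_normed_field, banach}, 'b, 'x) normed_space_scheme"
  assumes "banach_algebra B" and H: "closed_ideal H B"
  shows "banach_algebra (B\<lparr>carrier := H\<rparr>)"
proof -
  interpret B: banach_algebra B by fact
  have sub: "submodule H scalar_ring B" and closed: "closedin (norm_topology B) H"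
    and mult: "\<And>x y. x \<in> H \<Longrightarrow> y \<in> carrier B \<Longrightarrow> x \<otimes>\<^bsub>B\<^esub> y \<in> H"
    using H by (auto simp: closed_ideal_def)
  have HB: "H \<subseteq> carrier B"
    using B.submoduleE(1)[OF sub] .
  then have mem [simp]: "x \<in> carrier B" if "x \<in> H" for x
    using that by blast
  interpret M: Module.module scalar_ring "B\<lparr>carrier := H\<rparr>"
    using submodule.submodule_is_module[OF sub B.module_axioms] .
  interpret N: normed_module "B\<lparr>carrier := H\<rparr>"
    by unfold_locales (auto intro: B.nrm_triangle)
  have dist: "norm_dist (B\<lparr>carrier := H\<rparr>) x y = norm_dist B x y" if "x \<in> H" "y \<in> H" for x y
    using that minus_carrier_update[OF B.normed_module_axioms N.normed_module_axioms HB]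
    by (simp add: norm_dist_def)
  show ?thesis
  proof unfold_locales
    show "N.metric.mcomplete"
    proof (rule N.mcompleteI)
      fix \<sigma> :: "nat \<Rightarrow> 'b" assume \<sigma>: "\<And>n. \<sigma> n \<in> carrier (B\<lparr>carrier := H\<rparr>)"
        and cauchy: "\<And>e. 0 < e \<Longrightarrow> \<exists>N. \<forall>m\<ge>N. \<forall>n\<ge>N. 
          nrm (B\<lparr>carrier := H\<rparr>) (\<sigma> m \<ominus>\<^bsub>B\<lparr>carrier := H\<rparr>\<^esub> \<sigma> n) < e"
      have \<sigma>H: "\<sigma> n \<in> H" for n using \<sigma> by simp
      note minus = minus_carrier_update[OF B.normed_module_axioms N.normed_module_axioms HB]
      obtain l where l: "l \<in> carrier B" "(\<lambda>n. nrm B (\<sigma> n \<ominus>\<^bsub>B\<^esub> l)) \<longlonglongrightarrow> 0"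
        using B.cauchy_convergent[of \<sigma>] \<sigma>H cauchy by (auto simp: minus)
      then have "limitin B.metric.mtopology \<sigma> l sequentially"
        using \<sigma>H by (auto simp: B.metric.limitin_metric_dist_null B.norm_dist_eq)
      then have "l \<in> H"
        using closed \<sigma>H unfolding B.norm_topology_eq B.metric.metric_closedin_iff_sequentially_closed
        by blast
      with l \<sigma>H show "\<exists>l\<in>carrier (B\<lparr>carrier := H\<rparr>).
          (\<lambda>n. nrm (B\<lparr>carrier := H\<rparr>) (\<sigma> n \<ominus>\<^bsub>B\<lparr>carrier := H\<rparr>\<^esub> l)) \<longlonglongrightarrow> 0"
        by (auto simp: minus)
    qed
    show "bilinear_map (B\<lparr>carrier := H\<rparr>) (B\<lparr>carrier := H\<rparr>) (B\<lparr>carrier := H\<rparr>)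
        (monoid.mult (B\<lparr>carrier := H\<rparr>))"
      by (rule bilinear_mapI) (auto simp: mult)
  qed (auto simp: B.mult_assoc B.norm_mult intro: B.nrm_triangle)
qed

text \<open>The definite descriptions in \<open>kernel_bimodule\<close> do denote: the ideal
  property gives existence, injectivity of \<open>\<iota>\<close> uniqueness. The choice of
  \<open>b\<close> does not matter, as two preimages of the same element differ by an element of the
  kernel, and the kernel annihilates itself.\<close>

lemma kernel_action:
  fixes I :: "('k::{real_normed_field, banach}, 'i) normed_space"
  assumes "singular_extension I \<iota> B q A"
    and b: "b \<in> carrier B" and x: "x \<in> carrier I"
  shows "lact (kernel_bimodule I \<iota> B q) (q b) x \<in> carrier I"
    and "\<iota> (lact (kernel_bimodule I \<iota> B q) (q b) x) = b \<otimes>\<^bsub>B\<^esub> \<iota> x"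
    and "ract (kernel_bimodule I \<iota> B q) x (q b) \<in> carrier I"
    and "\<iota> (ract (kernel_bimodule I \<iota> B q) x (q b)) = \<iota> x \<otimes>\<^bsub>B\<^esub> b"
proof -
  interpret singular_extension I \<iota> B q A by fact
  interpret \<iota>: normed_linear I B \<iota>
    using iota_hom by unfold_locales (simp add: algebra_hom_def)
  interpret q: normed_linear B A q
    using q_hom by unfold_locales (simp add: algebra_hom_def)
  have null: "z \<otimes>\<^bsub>B\<^esub> \<iota> x = \<zero>\<^bsub>B\<^esub> \<and> \<iota> x \<otimes>\<^bsub>B\<^esub> z = \<zero>\<^bsub>B\<^esub>" if "z \<in> carrier B" "q z = \<zero>\<^bsub>A\<^esub>" for z
  proof -
    have "z \<in> \<iota> ` carrier I"
      unfolding exact using that by simp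
    then obtain y where y: "y \<in> carrier I" "z = \<iota> y"
      by auto
    then have "z \<otimes>\<^bsub>B\<^esub> \<iota> x = \<iota> (y \<otimes>\<^bsub>I\<^esub> x)" "\<iota> x \<otimes>\<^bsub>B\<^esub> z = \<iota> (x \<otimes>\<^bsub>I\<^esub> y)"
      using iota_hom x by (auto simp: algebra_hom_def)
    then show ?thesis
      using square_zero x y by simp
  qed
  have indep: "b' \<otimes>\<^bsub>B\<^esub> \<iota> x = b \<otimes>\<^bsub>B\<^esub> \<iota> x \<and> \<iota> x \<otimes>\<^bsub>B\<^esub> b' = \<iota> x \<otimes>\<^bsub>B\<^esub> b"
    if "b' \<in> carrier B" "q b' = q b" for b'
    using null[of "b' \<ominus>\<^bsub>B\<^esub> b"] that b x by (simp add: B.minus_eq_zero_iff)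
  have "b \<otimes>\<^bsub>B\<^esub> \<iota> x \<in> \<iota> ` carrier I" "\<iota> x \<otimes>\<^bsub>B\<^esub> b \<in> \<iota> ` carrier I"
    using ideal_closed b x by (simp_all add: closed_ideal_def)
  then obtain y z where y: "y \<in> carrier I" "\<iota> y = b \<otimes>\<^bsub>B\<^esub> \<iota> x"
    and z: "z \<in> carrier I" "\<iota> z = \<iota> x \<otimes>\<^bsub>B\<^esub> b"
    by (metis imageE)
  have "lact (kernel_bimodule I \<iota> B q) (q b) x = y"
    unfolding kernel_bimodule_def normed_space.defs bimodule.defs bimodule.simps
  proof (rule the_equality)
    show "y \<in> carrier I \<and> (\<forall>b'\<in>carrier B. q b' = q b \<longrightarrow> \<iota> y = b' \<otimes>\<^bsub>B\<^esub> \<iota> x)"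
      using y indep by metis
    show "y' = y" if "y' \<in> carrier I \<and> (\<forall>b'\<in>carrier B. q b' = q b \<longrightarrow> \<iota> y' = b' \<otimes>\<^bsub>B\<^esub> \<iota> x)" for y'
      using that y b iota_inj by (metis inj_on_eq_iff)
  qed
  with y show "lact (kernel_bimodule I \<iota> B q) (q b) x \<in> carrier I"
    and "\<iota> (lact (kernel_bimodule I \<iota> B q) (q b) x) = b \<otimes>\<^bsub>B\<^esub> \<iota> x" by auto
  have "ract (kernel_bimodule I \<iota> B q) x (q b) = z"
    unfolding kernel_bimodule_def normed_space.defs bimodule.defs bimodule.simps
  proof (rule the_equality)
    show "z \<in> carrier I \<and> (\<forall>b'\<in>carrier B. q b' = q b \<longrightarrow> \<iota> z = \<iota> x \<otimes>\<^bsub>B\<^esub> b')"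
      using z indep by metis
    show "z' = z" if "z' \<in> carrier I \<and> (\<forall>b'\<in>carrier B. q b' = q b \<longrightarrow> \<iota> z' = \<iota> x \<otimes>\<^bsub>B\<^esub> b')" for z'
      using that z b iota_inj by (metis inj_on_eq_iff)
  qed
  with z show "ract (kernel_bimodule I \<iota> B q) x (q b) \<in> carrier I"
    and "\<iota> (ract (kernel_bimodule I \<iota> B q) x (q b)) = \<iota> x \<otimes>\<^bsub>B\<^esub> b" by auto
qed

section \<open>Extensions seen through an embedding of the bimodule\<close>

text \<open>What remains of an extension by \<open>E\<close> once \<open>\<iota>\<close> and the
  bimodule isomorphism are merged into one map \<open>\<rho>\<close>. Its range is the kernel of
  \<open>q\<close>, and the actions on \<open>E\<close> become multiplication in \<open>B\<close> by
  arbitrary preimages.\<close>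

locale embedded_bimodule = banach_bimodule A E + B: banach_algebra B +
    \<rho>: normed_linear E B \<rho> + q: normed_linear B A q
  for A :: "('k::{real_normed_field, banach}, 'a, 'x) normed_space_scheme"
    and E :: "('k, 'a, 'e, 'y) bimodule_scheme"
    and B :: "('k, 'b, 'z) normed_space_scheme"
    and q :: "'b \<Rightarrow> 'a"
    and \<rho> :: "'e \<Rightarrow> 'b" +
  assumes q_mult: "b \<in> carrier B \<Longrightarrow> b' \<in> carrier B \<Longrightarrow> q (b \<otimes>\<^bsub>B\<^esub> b') = q b \<otimes>\<^bsub>A\<^esub> q b'"
    and rho_inj: "inj_on \<rho> (carrier E)"
    and rho_range: "\<rho> ` carrier E = {b \<in> carrier B. q b = \<zero>\<^bsub>A\<^esub>}"
    and rho_bounded: "bounded_map E B \<rho>"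
    and rho_bounded_below: "\<exists>K. \<forall>x\<in>carrier E. nrm E x \<le> K * nrm B (\<rho> x)"
    and rho_lact: "b \<in> carrier B \<Longrightarrow> x \<in> carrier E \<Longrightarrow> \<rho> (lact E (q b) x) = b \<otimes>\<^bsub>B\<^esub> \<rho> x"
    and rho_ract: "b \<in> carrier B \<Longrightarrow> x \<in> carrier E \<Longrightarrow> \<rho> (ract E x (q b)) = \<rho> x \<otimes>\<^bsub>B\<^esub> b"
    and rho_mult_rho: "x \<in> carrier E \<Longrightarrow> y \<in> carrier E \<Longrightarrow> \<rho> x \<otimes>\<^bsub>B\<^esub> \<rho> y = \<zero>\<^bsub>B\<^esub>"

text \<open>\<open>\<rho>\<close> is \<open>\<iota>\<close> after the inverse of the isomorphism
  \<open>\<phi>\<close>. Its range is the closed ideal, so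
  \<open>bounded_inverse_of_closed_range\<close> gives the lower bound that the definition of an
  extension leaves out.\<close>

lemma singular_extension_embedding:
  assumes "banach_algebra A" "banach_bimodule A E" "singular_extension_by A E I \<iota> B q"
  obtains \<rho> where "embedded_bimodule A E B q \<rho>"
proof -
  interpret banach_bimodule A E by fact
  interpret singular_extension I \<iota> B q A
    using assms(3) by (simp add: singular_extension_by_def)
  interpret \<iota>: normed_linear I B \<iota>
    using iota_hom by unfold_locales (simp add: algebra_hom_def)
  interpret q: normed_linear B A q
    using q_hom by unfold_locales (simp add: algebra_hom_def)
  let ?K = "kernel_bimodule I \<iota> B q"
  obtain \<phi> where \<phi>: "bimodule_iso A ?K E \<phi>"
    using assms(3) by (auto simp: singular_extension_by_def)
  have K_simps: "carrier ?K = carrier I" "add ?K = add I" "smult ?K = smult I" "nrm ?K = nrm I"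
    by (simp_all add: kernel_bimodule_def normed_space.defs bimodule.defs)
  have \<phi>_lin: "linear_map I E \<phi>" and \<phi>_bij: "bij_betw \<phi> (carrier I) (carrier E)"
    and \<phi>_bdd: "bounded_map I E \<phi>" and \<phi>_inv_bdd: "bounded_map E I (inv_into (carrier I) \<phi>)"
    and \<phi>_act: "\<And>a x. a \<in> carrier A \<Longrightarrow> x \<in> carrier I \<Longrightarrow>
      \<phi> (lact ?K a x) = lact E a (\<phi> x) \<and> \<phi> (ract ?K x a) = ract E (\<phi> x) a"
    using \<phi> by (auto simp: bimodule_iso_def K_simps linear_map_def bounded_map_def)
  interpret \<phi>: normed_linear I E \<phi> by unfold_locales (rule \<phi>_lin)
  define \<psi> where "\<psi> = inv_into (carrier I) \<phi>"
  have \<psi>: "\<psi> e \<in> carrier I" "\<phi> (\<psi> e) = e" if "e \<in> carrier E" for e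
    using \<phi>_bij that unfolding \<psi>_def bij_betw_def by (auto intro: inv_into_into f_inv_into_f)
  have \<psi>\<phi>: "\<psi> (\<phi> x) = x" if "x \<in> carrier I" for x
    using \<phi>_bij that unfolding \<psi>_def bij_betw_def by auto
  have \<psi>_lin: "linear_map E I \<psi>"
  proof (rule linear_mapI)
    fix x y assume x: "x \<in> carrier E" and y: "y \<in> carrier E"
    have "\<psi> (\<phi> (\<psi> x \<oplus>\<^bsub>I\<^esub> \<psi> y)) = \<psi> x \<oplus>\<^bsub>I\<^esub> \<psi> y"
      using x y \<psi> by (intro \<psi>\<phi>) auto
    then show "\<psi> (x \<oplus>\<^bsub>E\<^esub> y) = \<psi> x \<oplus>\<^bsub>I\<^esub> \<psi> y"
      using x y \<psi> by simp
  next
    fix c x assume x: "x \<in> carrier E"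
    have "\<psi> (\<phi> (c \<odot>\<^bsub>I\<^esub> \<psi> x)) = c \<odot>\<^bsub>I\<^esub> \<psi> x"
      using x \<psi> by (intro \<psi>\<phi>) auto
    then show "\<psi> (c \<odot>\<^bsub>E\<^esub> x) = c \<odot>\<^bsub>I\<^esub> \<psi> x"
      using x \<psi> by simp
  qed (rule \<psi>)
  interpret \<psi>: normed_linear E I \<psi> by unfold_locales (rule \<psi>_lin)
  define \<rho> where "\<rho> = (\<lambda>e. \<iota> (\<psi> e))"
  have \<rho>_lin: "linear_map E B \<rho>"
    by (rule linear_mapI) (auto simp: \<rho>_def)
  have \<psi>_image: "\<psi> ` carrier E = carrier I"
    using \<psi> \<psi>\<phi> by (force simp: image_iff)
  have \<rho>_image: "\<rho> ` carrier E = {b \<in> carrier B. q b = \<zero>\<^bsub>A\<^esub>}"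
    unfolding exact[symmetric] \<psi>_image[symmetric] by (simp add: \<rho>_def image_image)
  have inj: "inj_on \<rho> (carrier E)"
    using iota_inj \<psi> by (metis \<rho>_def inj_on_def)
  have bdd: "bounded_map E B \<rho>"
  proof -
    obtain K1 K2 where K: "\<And>x. x \<in> carrier I \<Longrightarrow> nrm B (\<iota> x) \<le> K1 * nrm I x"
      "\<And>x. x \<in> carrier E \<Longrightarrow> nrm I (\<psi> x) \<le> K2 * nrm E x"
      using iota_bounded \<phi>_inv_bdd by (auto simp: bounded_map_def \<psi>_def)
    have "nrm B (\<rho> x) \<le> (\<bar>K1\<bar> * K2) * nrm E x" if "x \<in> carrier E" for x
    proof -
      have "nrm B (\<rho> x) \<le> K1 * nrm I (\<psi> x)"
        using that \<psi> by (simp add: \<rho>_def K)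
      also have "\<dots> \<le> \<bar>K1\<bar> * nrm I (\<psi> x)"
        using that \<psi> by (intro mult_right_mono) auto
      also have "\<dots> \<le> \<bar>K1\<bar> * (K2 * nrm E x)"
        using that by (intro mult_left_mono K) auto
      finally show ?thesis by simp
    qed
    then show ?thesis by (auto simp: bounded_map_def)
  qed
  have closed: "closedin (norm_topology B) (\<rho> ` carrier E)"
    using ideal_closed by (simp add: closed_ideal_def \<rho>_image exact)
  have "embedded_bimodule A E B q \<rho>"
  proof unfold_locales
    show "linear_map E B \<rho>" by fact
    show "inj_on \<rho> (carrier E)" by fact
    show "\<rho> ` carrier E = {b \<in> carrier B. q b = \<zero>\<^bsub>A\<^esub>}" by fact
    show "bounded_map E B \<rho>" by fact
    show "\<exists>K. \<forall>x\<in>carrier E. nrm E x \<le> K * nrm B (\<rho> x)"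
      by (rule bounded_inverse_of_closed_range[OF E.banach_space_axioms B.banach_space_axioms
            \<rho>_lin bdd inj closed])
    show "q (x \<otimes>\<^bsub>B\<^esub> y) = q x \<otimes>\<^bsub>A\<^esub> q y" if "x \<in> carrier B" "y \<in> carrier B" for x y
      using q_hom that by (simp add: algebra_hom_def)
    fix b x assume b: "b \<in> carrier B" and x: "x \<in> carrier E"
    \<comment> \<open>\<open>\<psi>\<close> carries the actions on \<open>E\<close> to those on the
      kernel, and there \<open>kernel_action\<close> expresses them by products with
      \<open>b\<close>.\<close>
    note \<phi>_act[of "q b" "\<psi> x"] kernel_action[OF singular_extension_axioms, of b "\<psi> x"]
    then show "\<rho> (lact E (q b) x) = b \<otimes>\<^bsub>B\<^esub> \<rho> x" "\<rho> (ract E x (q b)) = \<rho> x \<otimes>\<^bsub>B\<^esub> b"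
      using b x \<psi>[OF x] \<psi>\<phi> by (metis \<rho>_def q.closed)+
  next
    fix x y assume x: "x \<in> carrier E" and y: "y \<in> carrier E"
    have "\<rho> x \<otimes>\<^bsub>B\<^esub> \<rho> y = \<iota> (\<psi> x \<otimes>\<^bsub>I\<^esub> \<psi> y)"
      using iota_hom x y \<psi> by (simp add: algebra_hom_def \<rho>_def)
    then show "\<rho> x \<otimes>\<^bsub>B\<^esub> \<rho> y = \<zero>\<^bsub>B\<^esub>"
      using square_zero x y \<psi> by simp
  qed
  then show thesis by (rule that)
qed

text \<open>\<open>q\<close> is multiplicative and \<open>Q\<close> is a section, so
  \<open>q\<close> kills the defect of \<open>Q\<close>. The cocycle identity then uses only
  associativity in \<open>A\<close> and \<open>B\<close>: with \<open>Q a\<close> acting in place of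
  \<open>a\<close>, all terms cancel, whether or not \<open>Q\<close> is bounded.\<close>

lemma (in embedded_bimodule) cocycle_of_section:
  assumes Q: "cf_homomorphism A B Q" and section_Q: "\<And>a. a \<in> carrier A \<Longrightarrow> q (Q a) = a"
  obtains T where "T \<in> Z2K A E"
    and "\<And>a b. a \<in> carrier A \<Longrightarrow> b \<in> carrier A \<Longrightarrow>
      \<rho> (T a b) = Q a \<otimes>\<^bsub>B\<^esub> Q b \<ominus>\<^bsub>B\<^esub> Q (a \<otimes>\<^bsub>A\<^esub> b)"
proof -
  interpret Q: normed_linear A B Q
    using Q by unfold_locales (simp add: cf_homomorphism_def)
  define S where "S = (\<lambda>a b. Q a \<otimes>\<^bsub>B\<^esub> Q b \<ominus>\<^bsub>B\<^esub> Q (a \<otimes>\<^bsub>A\<^esub> b))"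
  have S: "compact_bilinear_map A A B S"
    using Q by (simp add: cf_homomorphism_def S_def)
  interpret S: normed_bilinear A A B S
    using S by unfold_locales (simp add: compact_bilinear_map_def)
  define T where "T = (\<lambda>a b. inv_into (carrier E) \<rho> (S a b))"
  have "S a b \<in> \<rho> ` carrier E" if "a \<in> carrier A" "b \<in> carrier A" for a b
    using that unfolding rho_range S_def by (simp add: q_mult section_Q)
  then have T: "T a b \<in> carrier E" "\<rho> (T a b) = S a b" if "a \<in> carrier A" "b \<in> carrier A" for a b
    using that unfolding T_def by (auto intro: inv_into_into f_inv_into_f)
  have eqI: "x = y" if "x \<in> carrier E" "y \<in> carrier E" "\<rho> x = \<rho> y" for x y
    using rho_inj that by (simp add: inj_on_eq_iff)
  \<comment> \<open>\<open>\<rho>\<close> is linear and injective, so each equation for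
    \<open>T\<close> is checked in \<open>B\<close>, where \<open>\<rho>\<close> turns it into one
    for \<open>S\<close>.\<close>
  have bil: "bilinear_map A A E T"
    by (rule bilinear_mapI; (rule eqI)?) (auto simp: T)
  obtain K where K: "\<And>x. x \<in> carrier E \<Longrightarrow> nrm E x \<le> K * nrm B (\<rho> x)"
    using rho_bounded_below by blast
  \<comment> \<open>The lower bound for \<open>\<rho>\<close> estimates differences of
    \<open>T\<close> by differences of \<open>S\<close>; \<open>S\<close> is used in both slots,
    hence \<open>K / 2\<close>.\<close>
  have "compact_bilinear_map A A E T"
  proof (rule compact_bilinear_map_dominated[OF B.banach_space_axioms B.banach_space_axioms
        E.banach_space_axioms S S bil, where K = "K / 2"])
    show "nrm E (T x y \<ominus>\<^bsub>E\<^esub> T x' y') \<le>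
        K / 2 * (nrm B (S x y \<ominus>\<^bsub>B\<^esub> S x' y') + nrm B (S x y \<ominus>\<^bsub>B\<^esub> S x' y'))"
      if "x \<in> carrier A" "x' \<in> carrier A" "y \<in> carrier A" "y' \<in> carrier A" for x y x' y'
      using K[of "T x y \<ominus>\<^bsub>E\<^esub> T x' y'"] that T by simp
  qed
  moreover have "delta2 A E T a b c = \<zero>\<^bsub>E\<^esub>"
    if a: "a \<in> carrier A" and b: "b \<in> carrier A" and c: "c \<in> carrier A" for a b c
  proof (rule eqI)
    \<comment> \<open>\<open>Q a\<close> is a preimage of \<open>a\<close> under \<open>q\<close>,
      so multiplication by it computes the module action of \<open>a\<close>.\<close>
    have act: "\<rho> (lact E a (T b c)) = Q a \<otimes>\<^bsub>B\<^esub> S b c" "\<rho> (ract E (T a b) c) = S a b \<otimes>\<^bsub>B\<^esub> Q c"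
      using rho_lact[of "Q a" "T b c"] rho_ract[of "Q c" "T a b"] a b c T by (simp_all add: section_Q)
    have "\<rho> (delta2 A E T a b c) =
        Q a \<otimes>\<^bsub>B\<^esub> S b c \<ominus>\<^bsub>B\<^esub> S (a \<otimes>\<^bsub>A\<^esub> b) c \<oplus>\<^bsub>B\<^esub> S a (b \<otimes>\<^bsub>A\<^esub> c) \<ominus>\<^bsub>B\<^esub> S a b \<otimes>\<^bsub>B\<^esub> Q c"
      using a b c T by (simp add: delta2_def act)
    also have "\<dots> = \<zero>\<^bsub>B\<^esub>"
      using a b c B.four_term_cancel[of "Q a \<otimes>\<^bsub>B\<^esub> (Q b \<otimes>\<^bsub>B\<^esub> Q c)" "Q a \<otimes>\<^bsub>B\<^esub> Q (b \<otimes>\<^bsub>A\<^esub> c)"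
          "Q (a \<otimes>\<^bsub>A\<^esub> b) \<otimes>\<^bsub>B\<^esub> Q c" "Q (a \<otimes>\<^bsub>A\<^esub> (b \<otimes>\<^bsub>A\<^esub> c))"]
      by (simp add: S_def A.mult_assoc B.mult_assoc)
    finally show "\<rho> (delta2 A E T a b c) = \<rho> \<zero>\<^bsub>E\<^esub>" by simp
    show "delta2 A E T a b c \<in> carrier E"
      using a b c T by (simp add: delta2_def)
  qed simp
  ultimately have "T \<in> Z2K A E"
    by (simp add: Z2K_def)
  with T show thesis
    by (intro that[of T]) (auto simp: S_def)
qed

text \<open>In the product of \<open>Q a - \<rho> (S a)\<close> and
  \<open>Q b - \<rho> (S b)\<close> the last term vanishes because the kernel has square zero. The
  mixed terms are the images of the two actions in \<open>delta1\<close>, and what they leave of the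
  coboundary is the correction \<open>\<rho> (S (a b))\<close> at the product.\<close>

lemma (in embedded_bimodule) splitting_of_coboundary:
  assumes Q: "linear_map A B Q" and section_Q: "\<And>a. a \<in> carrier A \<Longrightarrow> q (Q a) = a"
    and S: "linear_map A E S"
    and cob: "\<And>a b. a \<in> carrier A \<Longrightarrow> b \<in> carrier A \<Longrightarrow>
      \<rho> (delta1 A E S a b) = Q a \<otimes>\<^bsub>B\<^esub> Q b \<ominus>\<^bsub>B\<^esub> Q (a \<otimes>\<^bsub>A\<^esub> b)"
  shows "algebra_hom A B (\<lambda>a. Q a \<ominus>\<^bsub>B\<^esub> \<rho> (S a))"
    and "\<And>a. a \<in> carrier A \<Longrightarrow> q (Q a \<ominus>\<^bsub>B\<^esub> \<rho> (S a)) = a"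
    and "bounded_map A B Q \<Longrightarrow> bounded_map A E S \<Longrightarrow> bounded_map A B (\<lambda>a. Q a \<ominus>\<^bsub>B\<^esub> \<rho> (S a))"
proof -
  interpret Q: normed_linear A B Q by unfold_locales fact
  interpret S: normed_linear A E S by unfold_locales fact
  have q_rho: "q (\<rho> x) = \<zero>\<^bsub>A\<^esub>" if "x \<in> carrier E" for x
    using rho_range that by blast
  show "q (Q a \<ominus>\<^bsub>B\<^esub> \<rho> (S a)) = a" if "a \<in> carrier A" for a
    using that by (simp add: section_Q q_rho)
  have lin: "linear_map A B (\<lambda>a. Q a \<ominus>\<^bsub>B\<^esub> \<rho> (S a))"
    by (rule linear_mapI) (auto simp: B.add_minus_add B.smult_minus)
  have "Q (a \<otimes>\<^bsub>A\<^esub> b) \<ominus>\<^bsub>B\<^esub> \<rho> (S (a \<otimes>\<^bsub>A\<^esub> b)) = (Q a \<ominus>\<^bsub>B\<^esub> \<rho> (S a)) \<otimes>\<^bsub>B\<^esub> (Q b \<ominus>\<^bsub>B\<^esub> \<rho> (S b))"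
    if a: "a \<in> carrier A" and b: "b \<in> carrier A" for a b
  proof -
    let ?X = "Q a \<otimes>\<^bsub>B\<^esub> Q b" and ?L = "Q a \<otimes>\<^bsub>B\<^esub> \<rho> (S b)" and ?R = "\<rho> (S a) \<otimes>\<^bsub>B\<^esub> Q b"
      and ?W = "\<rho> (S (a \<otimes>\<^bsub>A\<^esub> b))"
    have "\<rho> (lact E a (S b)) = ?L" "\<rho> (ract E (S a) b) = ?R"
      using rho_lact[of "Q a" "S b"] rho_ract[of "Q b" "S a"] a b by (simp_all add: section_Q)
    then have "?L \<ominus>\<^bsub>B\<^esub> ?W \<oplus>\<^bsub>B\<^esub> ?R = ?X \<ominus>\<^bsub>B\<^esub> Q (a \<otimes>\<^bsub>A\<^esub> b)"
      using cob[OF a b] a b by (simp add: delta1_def)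
    then have X: "?X = ?L \<ominus>\<^bsub>B\<^esub> ?W \<oplus>\<^bsub>B\<^esub> ?R \<oplus>\<^bsub>B\<^esub> Q (a \<otimes>\<^bsub>A\<^esub> b)"
      using a b by (simp add: B.minus_add_cancel)
    have "(Q a \<ominus>\<^bsub>B\<^esub> \<rho> (S a)) \<otimes>\<^bsub>B\<^esub> (Q b \<ominus>\<^bsub>B\<^esub> \<rho> (S b)) = ?X \<ominus>\<^bsub>B\<^esub> ?R \<ominus>\<^bsub>B\<^esub> ?L"
      using a b by (simp add: rho_mult_rho)
    also have "\<dots> = Q (a \<otimes>\<^bsub>A\<^esub> b) \<ominus>\<^bsub>B\<^esub> ?W"
    proof -
      have "?X = Q (a \<otimes>\<^bsub>A\<^esub> b) \<ominus>\<^bsub>B\<^esub> ?W \<oplus>\<^bsub>B\<^esub> ?L \<oplus>\<^bsub>B\<^esub> ?R"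
        unfolding X using a b by (simp add: B.M.minus_eq B.M.a_ac)
      then show ?thesis
        using a b by (simp add: B.minus_eq_iff)
    qed
    finally show ?thesis by simp
  qed
  with lin show "algebra_hom A B (\<lambda>a. Q a \<ominus>\<^bsub>B\<^esub> \<rho> (S a))"
    by (simp add: algebra_hom_def)
  assume "bounded_map A B Q" "bounded_map A E S"
  then obtain K1 K2 K3 where K: "\<And>a. a \<in> carrier A \<Longrightarrow> nrm B (Q a) \<le> K1 * nrm A a"
    "\<And>a. a \<in> carrier A \<Longrightarrow> nrm E (S a) \<le> K2 * nrm A a"
    "\<And>x. x \<in> carrier E \<Longrightarrow> nrm B (\<rho> x) \<le> K3 * nrm E x"
    using rho_bounded unfolding bounded_map_def by metis
  have "nrm B (Q a \<ominus>\<^bsub>B\<^esub> \<rho> (S a)) \<le> (K1 + \<bar>K3\<bar> * K2) * nrm A a" if a: "a \<in> carrier A" for a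
  proof -
    have "nrm B (\<rho> (S a)) \<le> K3 * nrm E (S a)"
      using a by (intro K) auto
    also have "\<dots> \<le> \<bar>K3\<bar> * nrm E (S a)"
      using a by (intro mult_right_mono) auto
    also have "\<dots> \<le> \<bar>K3\<bar> * (K2 * nrm A a)"
      using a by (intro mult_left_mono K) auto
    finally show ?thesis
      using B.nrm_triangle_minus[of "Q a" "\<rho> (S a)"] K(1)[OF a] a by (simp add: algebra_simps)
  qed
  then show "bounded_map A B (\<lambda>a. Q a \<ominus>\<^bsub>B\<^esub> \<rho> (S a))"
    by (auto simp: bounded_map_def)
qed

section \<open>From cocycles to extensions\<close>

text \<open>The constant \<open>c\<close> is large enough for the norm \<open>nrm x + c * nrm a\<close> on \<open>E \<times> A\<close> to be
  submultiplicative; \<open>j\<close> moves the extension into the type over which the theorem quantifies.\<close>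

locale cocycle_extension = banach_bimodule A E
  for A :: "('k::{real_normed_field, banach}, 'a) normed_space"
    and E :: "('k, 'a, 'e) bimodule" +
  fixes T :: "'a \<Rightarrow> 'a \<Rightarrow> 'e" and c :: real and j :: "'e \<times> 'a \<Rightarrow> 'u"
  assumes cocycle: "T \<in> Z2K A E"
    and j_inj: "inj_on j (carrier E \<times> carrier A)"
    and c_pos: "0 < c"
    and lact_le: "a \<in> carrier A \<Longrightarrow> x \<in> carrier E \<Longrightarrow> nrm E (lact E a x) \<le> c * nrm A a * nrm E x"
    and ract_le: "a \<in> carrier A \<Longrightarrow> x \<in> carrier E \<Longrightarrow> nrm E (ract E x a) \<le> c * nrm A a * nrm E x"
    and T_le: "a \<in> carrier A \<Longrightarrow> b \<in> carrier A \<Longrightarrow>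
      nrm E (T a b) \<le> (c * c - c) * nrm A a * nrm A b"
begin

definition g :: "'u \<Rightarrow> 'e \<times> 'a" where
  "g = inv_into (carrier E \<times> carrier A) j"

lemma g_j [simp]: "x \<in> carrier E \<Longrightarrow> a \<in> carrier A \<Longrightarrow> g (j (x, a)) = (x, a)"
  using j_inj by (simp add: g_def)

definition B :: "('k, 'u) normed_space" where
  "B = \<lparr>carrier = j ` (carrier E \<times> carrier A),
    monoid.mult = (\<lambda>u v. j (ract E (fst (g u)) (snd (g v)) \<oplus>\<^bsub>E\<^esub> lact E (snd (g u)) (fst (g v))
        \<oplus>\<^bsub>E\<^esub> T (snd (g u)) (snd (g v)), snd (g u) \<otimes>\<^bsub>A\<^esub> snd (g v))),
    one = j (\<zero>\<^bsub>E\<^esub>, \<zero>\<^bsub>A\<^esub>),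
    zero = j (\<zero>\<^bsub>E\<^esub>, \<zero>\<^bsub>A\<^esub>),
    add = (\<lambda>u v. j (fst (g u) \<oplus>\<^bsub>E\<^esub> fst (g v), snd (g u) \<oplus>\<^bsub>A\<^esub> snd (g v))),
    smult = (\<lambda>k u. j (k \<odot>\<^bsub>E\<^esub> fst (g u), k \<odot>\<^bsub>A\<^esub> snd (g u))),
    nrm = (\<lambda>u. nrm E (fst (g u)) + c * nrm A (snd (g u)))\<rparr>"

definition q :: "'u \<Rightarrow> 'a" where "q u = snd (g u)"

text \<open>A restriction of \<open>B\<close> within the same type, so that the embedding of the
  kernel is the identity.\<close>

definition I :: "('k, 'u) normed_space" where
  "I = B\<lparr>carrier := j ` (carrier E \<times> {\<zero>\<^bsub>A\<^esub>})\<rparr>"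

sublocale T: normed_bilinear A A E T
  using cocycle by unfold_locales (simp add: Z2K_def compact_bilinear_map_def)

lemma B_carrierE:
  assumes "u \<in> carrier B"
  obtains x a where "x \<in> carrier E" "a \<in> carrier A" "u = j (x, a)"
  using assms by (auto simp: B_def)

lemma j_closed [simp, intro]: "x \<in> carrier E \<Longrightarrow> a \<in> carrier A \<Longrightarrow> j (x, a) \<in> carrier B"
  by (simp add: B_def)

lemma B_zero: "\<zero>\<^bsub>B\<^esub> = j (\<zero>\<^bsub>E\<^esub>, \<zero>\<^bsub>A\<^esub>)"
  by (simp add: B_def)

lemma j_smult:
  "x \<in> carrier E \<Longrightarrow> a \<in> carrier A \<Longrightarrow> k \<odot>\<^bsub>B\<^esub> j (x, a) = j (k \<odot>\<^bsub>E\<^esub> x, k \<odot>\<^bsub>A\<^esub> a)"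
  by (simp add: B_def)

lemma j_nrm:
  "x \<in> carrier E \<Longrightarrow> a \<in> carrier A \<Longrightarrow> nrm B (j (x, a)) = nrm E x + c * nrm A a"
  by (simp add: B_def)

lemma q_j: "x \<in> carrier E \<Longrightarrow> a \<in> carrier A \<Longrightarrow> q (j (x, a)) = a"
  by (simp add: q_def)

context
  fixes x y a b
  assumes mem: "x \<in> carrier E" "y \<in> carrier E" "a \<in> carrier A" "b \<in> carrier A"
begin

lemma j_add: "j (x, a) \<oplus>\<^bsub>B\<^esub> j (y, b) = j (x \<oplus>\<^bsub>E\<^esub> y, a \<oplus>\<^bsub>A\<^esub> b)"
  using mem by (simp add: B_def)

lemma j_mult:
  "j (x, a) \<otimes>\<^bsub>B\<^esub> j (y, b) = j (ract E x b \<oplus>\<^bsub>E\<^esub> lact E a y \<oplus>\<^bsub>E\<^esub> T a b, a \<otimes>\<^bsub>A\<^esub> b)"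
  using mem by (simp add: B_def)

lemma j_eq_iff: "j (x, a) = j (y, b) \<longleftrightarrow> x = y \<and> a = b"
  using mem by (metis g_j prod.inject)

end

lemmas j_simps = B_zero j_add j_mult j_smult j_nrm j_eq_iff q_j

section \<open>The twisted product as a Banach algebra\<close>

lemma normed_module_B: "normed_module B"
proof -
  have "abelian_group B"
  proof (rule abelian_groupI)
    fix u assume "u \<in> carrier B"
    then obtain x a where "x \<in> carrier E" "a \<in> carrier A" "u = j (x, a)"
      by (rule B_carrierE)
    then show "\<exists>v\<in>carrier B. v \<oplus>\<^bsub>B\<^esub> u = \<zero>\<^bsub>B\<^esub>"
      by (intro bexI[of _ "j (\<ominus>\<^bsub>E\<^esub> x, \<ominus>\<^bsub>A\<^esub> a)"]) (simp_all add: j_simps E.M.l_neg A.M.l_neg)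
  qed (auto elim!: B_carrierE simp: j_simps E.M.a_ac A.M.a_ac)
  moreover have "cring (scalar_ring :: 'k ring)"
    by (rule A.R.is_cring)
  ultimately have "Module.module scalar_ring B"
    by (intro moduleI)
      (auto elim!: B_carrierE simp: j_simps E.smult_l_distr[simplified] A.smult_l_distr[simplified]
        E.smult_r_distr[simplified] A.smult_r_distr[simplified])
  then interpret M: Module.module scalar_ring B .
  show ?thesis
  proof unfold_locales
    fix u assume "u \<in> carrier B"
    then obtain x a where u: "x \<in> carrier E" "a \<in> carrier A" "u = j (x, a)"
      by (rule B_carrierE)
    then show "0 \<le> nrm B u"
      using c_pos by (simp add: j_simps)
    show "nrm B u = 0 \<longleftrightarrow> u = \<zero>\<^bsub>B\<^esub>"
      using u c_pos by (simp add: j_simps add_nonneg_eq_0_iff)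
    show "nrm B (k \<odot>\<^bsub>B\<^esub> u) = norm k * nrm B u" for k
      using u by (simp add: j_simps algebra_simps)
    fix v assume "v \<in> carrier B"
    then obtain y b where v: "y \<in> carrier E" "b \<in> carrier A" "v = j (y, b)"
      by (rule B_carrierE)
    have "c * nrm A (a \<oplus>\<^bsub>A\<^esub> b) \<le> c * (nrm A a + nrm A b)"
      using u v c_pos by (intro mult_left_mono A.nrm_triangle) auto
    then show "nrm B (u \<oplus>\<^bsub>B\<^esub> v) \<le> nrm B u + nrm B v"
      using u v E.nrm_triangle[of x y] by (simp add: j_simps algebra_simps)
  qed
qed

sublocale B: normed_module B
  by (rule normed_module_B)

lemma j_uminus: "x \<in> carrier E \<Longrightarrow> a \<in> carrier A \<Longrightarrow> \<ominus>\<^bsub>B\<^esub> j (x, a) = j (\<ominus>\<^bsub>E\<^esub> x, \<ominus>\<^bsub>A\<^esub> a)"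
  by (simp add: B.uminus_eq_smult E.uminus_eq_smult A.uminus_eq_smult j_simps)

lemma j_minus:
  "x \<in> carrier E \<Longrightarrow> y \<in> carrier E \<Longrightarrow> a \<in> carrier A \<Longrightarrow> b \<in> carrier A \<Longrightarrow>
    j (x, a) \<ominus>\<^bsub>B\<^esub> j (y, b) = j (x \<ominus>\<^bsub>E\<^esub> y, a \<ominus>\<^bsub>A\<^esub> b)"
  by (simp add: B.M.minus_eq E.M.minus_eq A.M.minus_eq j_uminus j_simps)

text \<open>The subtraction-free form of \<open>delta2 T = 0\<close>: it equates the
  \<open>T\<close>-terms that the two bracketings of a triple product leave in the first
  coordinate.\<close>

lemma cocycle_identity:
  assumes "a \<in> carrier A" "b \<in> carrier A" "d \<in> carrier A"
  shows "lact E a (T b d) \<oplus>\<^bsub>E\<^esub> T a (b \<otimes>\<^bsub>A\<^esub> d) = ract E (T a b) d \<oplus>\<^bsub>E\<^esub> T (a \<otimes>\<^bsub>A\<^esub> b) d"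
proof -
  have "lact E a (T b d) \<ominus>\<^bsub>E\<^esub> T (a \<otimes>\<^bsub>A\<^esub> b) d \<oplus>\<^bsub>E\<^esub> T a (b \<otimes>\<^bsub>A\<^esub> d) \<ominus>\<^bsub>E\<^esub> ract E (T a b) d = \<zero>\<^bsub>E\<^esub>"
    using cocycle assms by (auto simp: Z2K_def delta2_def)
  then have "lact E a (T b d) \<ominus>\<^bsub>E\<^esub> T (a \<otimes>\<^bsub>A\<^esub> b) d \<oplus>\<^bsub>E\<^esub> T a (b \<otimes>\<^bsub>A\<^esub> d) = ract E (T a b) d"
    using assms by (simp add: E.minus_eq_iff)
  moreover have "lact E a (T b d) \<oplus>\<^bsub>E\<^esub> T a (b \<otimes>\<^bsub>A\<^esub> d) =
      lact E a (T b d) \<ominus>\<^bsub>E\<^esub> T (a \<otimes>\<^bsub>A\<^esub> b) d \<oplus>\<^bsub>E\<^esub> T a (b \<otimes>\<^bsub>A\<^esub> d) \<oplus>\<^bsub>E\<^esub> T (a \<otimes>\<^bsub>A\<^esub> b) d"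
  proof -
    have "lact E a (T b d) \<ominus>\<^bsub>E\<^esub> T (a \<otimes>\<^bsub>A\<^esub> b) d \<oplus>\<^bsub>E\<^esub> T a (b \<otimes>\<^bsub>A\<^esub> d) \<oplus>\<^bsub>E\<^esub> T (a \<otimes>\<^bsub>A\<^esub> b) d =
      (lact E a (T b d) \<ominus>\<^bsub>E\<^esub> T (a \<otimes>\<^bsub>A\<^esub> b) d \<oplus>\<^bsub>E\<^esub> T (a \<otimes>\<^bsub>A\<^esub> b) d) \<oplus>\<^bsub>E\<^esub> T a (b \<otimes>\<^bsub>A\<^esub> d)"
      using assms by (simp add: E.M.a_ac)
    then show ?thesis
      using assms by (simp add: E.minus_add_cancel)
  qed
  ultimately show ?thesis
    by simp
qed

text \<open>The norm of \<open>B\<close> dominates each coordinate up to a constant, so a Cauchy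
  sequence is Cauchy in both, and the pair of limits is its limit.\<close>

lemma complete_B: "B.metric.mcomplete"
proof (rule B.mcompleteI)
  fix \<sigma> :: "nat \<Rightarrow> 'u" assume \<sigma>: "\<And>n. \<sigma> n \<in> carrier B"
    and cauchy: "\<And>e. 0 < e \<Longrightarrow> \<exists>N. \<forall>m\<ge>N. \<forall>n\<ge>N. nrm B (\<sigma> m \<ominus>\<^bsub>B\<^esub> \<sigma> n) < e"
  have "\<forall>n. \<exists>x a. x \<in> carrier E \<and> a \<in> carrier A \<and> \<sigma> n = j (x, a)"
    using \<sigma> B_carrierE by metis
  then obtain x a where xa: "\<And>n. x n \<in> carrier E" "\<And>n. a n \<in> carrier A" "\<And>n. \<sigma> n = j (x n, a n)"
    by metis
  have nrm: "nrm B (\<sigma> m \<ominus>\<^bsub>B\<^esub> j (y, b)) = nrm E (x m \<ominus>\<^bsub>E\<^esub> y) + c * nrm A (a m \<ominus>\<^bsub>A\<^esub> b)"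
    if "y \<in> carrier E" "b \<in> carrier A" for m y b
    using xa(1,2) that by (simp add: xa(3) j_minus j_simps)
  obtain y where y: "y \<in> carrier E" "(\<lambda>n. nrm E (x n \<ominus>\<^bsub>E\<^esub> y)) \<longlonglongrightarrow> 0"
  proof -
    have "\<exists>y\<in>carrier E. (\<lambda>n. nrm E (x n \<ominus>\<^bsub>E\<^esub> y)) \<longlonglongrightarrow> 0"
    proof (rule E.cauchy_convergent[OF xa(1)])
      fix e :: real assume "0 < e"
      then obtain N where N: "\<And>m n. m \<ge> N \<Longrightarrow> n \<ge> N \<Longrightarrow> nrm B (\<sigma> m \<ominus>\<^bsub>B\<^esub> \<sigma> n) < e"
        using cauchy by meson
      have "nrm E (x m \<ominus>\<^bsub>E\<^esub> x n) < e" if "m \<ge> N" "n \<ge> N" for m n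
      proof -
        have "0 \<le> c * nrm A (a m \<ominus>\<^bsub>A\<^esub> a n)"
          using c_pos xa by simp
        then show ?thesis
          using N[OF that] nrm[OF xa(1) xa(2), of m n n] by (simp add: xa(3))
      qed
      then show "\<exists>N. \<forall>m\<ge>N. \<forall>n\<ge>N. nrm E (x m \<ominus>\<^bsub>E\<^esub> x n) < e" by blast
    qed
    then show thesis using that by blast
  qed
  obtain b where b: "b \<in> carrier A" "(\<lambda>n. nrm A (a n \<ominus>\<^bsub>A\<^esub> b)) \<longlonglongrightarrow> 0"
  proof -
    have "\<exists>b\<in>carrier A. (\<lambda>n. nrm A (a n \<ominus>\<^bsub>A\<^esub> b)) \<longlonglongrightarrow> 0"
    proof (rule A.cauchy_convergent[OF xa(2)])
      fix e :: real assume "0 < e"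
      \<comment> \<open>The second coordinate enters the norm with weight \<open>c\<close>, so the
        tolerance is scaled accordingly.\<close>
      then have "0 < c * e" using c_pos by simp
      then obtain N where N: "\<And>m n. m \<ge> N \<Longrightarrow> n \<ge> N \<Longrightarrow> nrm B (\<sigma> m \<ominus>\<^bsub>B\<^esub> \<sigma> n) < c * e"
        using cauchy by meson
      have "nrm A (a m \<ominus>\<^bsub>A\<^esub> a n) < e" if "m \<ge> N" "n \<ge> N" for m n
      proof -
        have "0 \<le> nrm E (x m \<ominus>\<^bsub>E\<^esub> x n)"
          using xa by simp
        then have "c * nrm A (a m \<ominus>\<^bsub>A\<^esub> a n) < c * e"
          using N[OF that] nrm[OF xa(1) xa(2), of m n n] by (simp add: xa(3))
        then show ?thesis using c_pos by simp
      qed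
      then show "\<exists>N. \<forall>m\<ge>N. \<forall>n\<ge>N. nrm A (a m \<ominus>\<^bsub>A\<^esub> a n) < e" by blast
    qed
    then show thesis using that by blast
  qed
  have "(\<lambda>n. nrm E (x n \<ominus>\<^bsub>E\<^esub> y) + c * nrm A (a n \<ominus>\<^bsub>A\<^esub> b)) \<longlonglongrightarrow> 0 + c * 0"
    using y b by (intro tendsto_intros)
  then show "\<exists>l\<in>carrier B. (\<lambda>n. nrm B (\<sigma> n \<ominus>\<^bsub>B\<^esub> l)) \<longlonglongrightarrow> 0"
    using y b by (intro bexI[of _ "j (y, b)"]) (simp_all add: nrm)
qed

lemma banach_algebra_B: "banach_algebra B"
proof unfold_locales
  show "B.metric.mcomplete" by (rule complete_B)
  show "bilinear_map B B B (monoid.mult B)"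
    by (rule bilinear_mapI)
      (auto elim!: B_carrierE simp: j_simps E.smult_r_distr[simplified] E.M.a_ac)
  fix u v assume "u \<in> carrier B" "v \<in> carrier B"
  then obtain x a y b where u: "x \<in> carrier E" "a \<in> carrier A" "u = j (x, a)"
    and v: "y \<in> carrier E" "b \<in> carrier A" "v = j (y, b)"
    by (meson B_carrierE)
  \<comment> \<open>In the product of the two norms, the mixed summands pay for the actions. Of the
    summand with \<open>c * c\<close>, the part \<open>c * c - c\<close> pays for
    \<open>T a b\<close> and the remaining \<open>c\<close> for the product in
    \<open>A\<close>.\<close>
  show "nrm B (u \<otimes>\<^bsub>B\<^esub> v) \<le> nrm B u * nrm B v"
  proof -
    have "nrm E (ract E x b \<oplus>\<^bsub>E\<^esub> lact E a y \<oplus>\<^bsub>E\<^esub> T a b)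
        \<le> nrm E (ract E x b) + nrm E (lact E a y) + nrm E (T a b)"
      using u v E.nrm_triangle[of "ract E x b \<oplus>\<^bsub>E\<^esub> lact E a y" "T a b"]
        E.nrm_triangle[of "ract E x b" "lact E a y"] by simp
    also have "\<dots> \<le> c * nrm A b * nrm E x + c * nrm A a * nrm E y + (c * c - c) * nrm A a * nrm A b"
      using u v by (intro add_mono ract_le lact_le T_le)
    finally have "nrm B (u \<otimes>\<^bsub>B\<^esub> v) \<le> c * nrm A b * nrm E x + c * nrm A a * nrm E y
        + (c * c - c) * nrm A a * nrm A b + c * nrm A (a \<otimes>\<^bsub>A\<^esub> b)"
      using u v by (simp add: j_simps)
    moreover have "c * nrm A (a \<otimes>\<^bsub>A\<^esub> b) \<le> c * (nrm A a * nrm A b)"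
      using u v c_pos by (intro mult_left_mono A.norm_mult) auto
    moreover have "0 \<le> nrm E x * nrm E y"
      using u v by simp
    moreover have "nrm B u * nrm B v = nrm E x * nrm E y + c * nrm A b * nrm E x
        + c * nrm A a * nrm E y + (c * c - c) * nrm A a * nrm A b + c * (nrm A a * nrm A b)"
      using u v by (simp add: j_simps algebra_simps)
    ultimately show ?thesis by linarith
  qed
  fix w assume "w \<in> carrier B"
  then obtain z d where w: "z \<in> carrier E" "d \<in> carrier A" "w = j (z, d)"
    by (rule B_carrierE)
  \<comment> \<open>The terms in \<open>x\<close>, \<open>y\<close> and \<open>z\<close> agree by
    the three associativity laws of a bimodule, and those in \<open>T\<close> by
    \<open>cocycle_identity\<close>.\<close>
  have "ract E (ract E x b \<oplus>\<^bsub>E\<^esub> lact E a y \<oplus>\<^bsub>E\<^esub> T a b) d \<oplus>\<^bsub>E\<^esub> lact E (a \<otimes>\<^bsub>A\<^esub> b) z \<oplus>\<^bsub>E\<^esub> T (a \<otimes>\<^bsub>A\<^esub> b) d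
      = ract E x (b \<otimes>\<^bsub>A\<^esub> d) \<oplus>\<^bsub>E\<^esub> lact E a (ract E y d \<oplus>\<^bsub>E\<^esub> lact E b z \<oplus>\<^bsub>E\<^esub> T b d) \<oplus>\<^bsub>E\<^esub> T a (b \<otimes>\<^bsub>A\<^esub> d)"
  proof -
    have "ract E (ract E x b \<oplus>\<^bsub>E\<^esub> lact E a y \<oplus>\<^bsub>E\<^esub> T a b) d \<oplus>\<^bsub>E\<^esub> lact E (a \<otimes>\<^bsub>A\<^esub> b) z \<oplus>\<^bsub>E\<^esub> T (a \<otimes>\<^bsub>A\<^esub> b) d
      = (ract E (ract E x b) d \<oplus>\<^bsub>E\<^esub> ract E (lact E a y) d \<oplus>\<^bsub>E\<^esub> lact E (a \<otimes>\<^bsub>A\<^esub> b) z)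
        \<oplus>\<^bsub>E\<^esub> (ract E (T a b) d \<oplus>\<^bsub>E\<^esub> T (a \<otimes>\<^bsub>A\<^esub> b) d)"
      using u v w by (simp add: E.M.a_ac)
    also have "\<dots> = (ract E x (b \<otimes>\<^bsub>A\<^esub> d) \<oplus>\<^bsub>E\<^esub> lact E a (ract E y d) \<oplus>\<^bsub>E\<^esub> lact E a (lact E b z))
        \<oplus>\<^bsub>E\<^esub> (lact E a (T b d) \<oplus>\<^bsub>E\<^esub> T a (b \<otimes>\<^bsub>A\<^esub> d))"
      using u v w by (simp add: cocycle_identity ract_assoc lact_assoc lact_ract)
    also have "\<dots> = ract E x (b \<otimes>\<^bsub>A\<^esub> d) \<oplus>\<^bsub>E\<^esub> lact E a (ract E y d \<oplus>\<^bsub>E\<^esub> lact E b z \<oplus>\<^bsub>E\<^esub> T b d)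
        \<oplus>\<^bsub>E\<^esub> T a (b \<otimes>\<^bsub>A\<^esub> d)"
      using u v w by (simp add: E.M.a_ac)
    finally show ?thesis .
  qed
  then show "(u \<otimes>\<^bsub>B\<^esub> v) \<otimes>\<^bsub>B\<^esub> w = u \<otimes>\<^bsub>B\<^esub> (v \<otimes>\<^bsub>B\<^esub> w)"
    using u v w by (simp add: j_simps A.mult_assoc)
qed (auto intro: B.nrm_triangle)

sublocale B: banach_algebra B
  by (rule banach_algebra_B)

lemma q_linear: "linear_map B A q"
  by (rule linear_mapI) (auto elim!: B_carrierE simp: j_simps)

lemma q_bounded: "bounded_map B A q"
proof -
  have "nrm A (q u) \<le> inverse c * nrm B u" if "u \<in> carrier B" for u
  proof -
    obtain x a where u: "x \<in> carrier E" "a \<in> carrier A" "u = j (x, a)"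
      using \<open>u \<in> carrier B\<close> by (rule B_carrierE)
    then have "c * nrm A (q u) \<le> nrm B u"
      by (simp add: j_simps)
    then show ?thesis
      using c_pos by (simp add: field_simps)
  qed
  then show ?thesis by (auto simp: bounded_map_def)
qed

sublocale q: normed_linear B A q
  by unfold_locales (rule q_linear)

section \<open>The singular extension and its kernel\<close>

lemma carrier_I: "carrier I = {u \<in> carrier B. q u = \<zero>\<^bsub>A\<^esub>}"
  by (auto simp: I_def j_simps elim!: B_carrierE)

text \<open>Closed as the preimage of a point under the continuous map \<open>q\<close> into a
  Hausdorff space.\<close>

lemma closed_ideal_I: "closed_ideal (carrier I) B"
  unfolding closed_ideal_def
proof (intro conjI ballI)
  show "submodule (carrier I) scalar_ring B"
    by (rule B.submoduleI) (auto simp: carrier_I)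
  have "closedin (norm_topology A) {\<zero>\<^bsub>A\<^esub>}"
    using closedin_Hausdorff_singleton[OF A.metric.Hausdorff_space_mtopology]
    by (simp add: A.norm_topology_eq)
  then have "closedin (norm_topology B) {u \<in> topspace (norm_topology B). q u \<in> {\<zero>\<^bsub>A\<^esub>}}"
    using q.continuous_iff_bounded q_bounded by (intro closedin_continuous_map_preimage) auto
  then show "closedin (norm_topology B) (carrier I)"
    by (simp add: carrier_I B.norm_topology_eq)
qed (auto simp: carrier_I j_simps elim!: B_carrierE)

lemma singular_extension_I: "singular_extension I (\<lambda>u. u) B q A"
proof -
  have I_simps: "add I = add B" "smult I = smult B" "monoid.mult I = monoid.mult B" "nrm I = nrm B"
    "zero I = zero B"
    by (simp_all add: I_def)
  interpret I: banach_algebra I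
    using closed_ideal_banach_algebra[OF banach_algebra_B closed_ideal_I] by (simp add: I_def)
  show ?thesis
  proof unfold_locales
    show "algebra_hom I B (\<lambda>u. u)"
      by (auto simp: algebra_hom_def linear_map_def I_simps carrier_I)
    show "bounded_map I B (\<lambda>u. u)"
      by (auto simp: bounded_map_def I_simps intro!: exI[of _ 1])
    show "algebra_hom B A q"
      using q_linear by (auto simp: algebra_hom_def j_simps elim!: B_carrierE)
    show "bounded_map B A q" by (rule q_bounded)
    show "inj_on (\<lambda>u. u) (carrier I)" by simp
    show "(\<lambda>u. u) ` carrier I = {b \<in> carrier B. q b = \<zero>\<^bsub>A\<^esub>}" by (simp add: carrier_I)
    show "q ` carrier B = carrier A"
    proof
      show "carrier A \<subseteq> q ` carrier B"
      proof
        fix a assume "a \<in> carrier A"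
        then show "a \<in> q ` carrier B"
          by (intro image_eqI[of _ _ "j (\<zero>\<^bsub>E\<^esub>, a)"]) (simp_all add: j_simps)
      qed
    qed auto
    show "closed_ideal ((\<lambda>u. u) ` carrier I) B" using closed_ideal_I by simp
    \<comment> \<open>In the product of \<open>(x, 0)\<close> and \<open>(y, 0)\<close> both actions
      and \<open>T\<close> are evaluated at the zero of \<open>A\<close>.\<close>
    show "x \<otimes>\<^bsub>I\<^esub> y = \<zero>\<^bsub>I\<^esub>" if "x \<in> carrier I" "y \<in> carrier I" for x y
      using that unfolding I_simps by (auto simp: carrier_I j_simps elim!: B_carrierE)
  qed
qed

text \<open>The twist is invisible on the kernel: \<open>T\<close> vanishes when one argument is
  zero, so multiplying \<open>(x, 0)\<close> by the lift \<open>(0, a)\<close> gives exactly the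
  original actions on \<open>E\<close>. As the weight \<open>c\<close> only meets the zero of
  \<open>A\<close>, the identification with \<open>E\<close> is isometric.\<close>

lemma singular_extension_by_I: "singular_extension_by A E I (\<lambda>u. u) B q"
proof -
  interpret singular_extension I "\<lambda>u. u" B q A by (rule singular_extension_I)
  let ?K = "kernel_bimodule I (\<lambda>u. u) B q" and ?\<phi> = "\<lambda>u. fst (g u)"
  have K_simps: "carrier ?K = carrier I" "add ?K = add B" "smult ?K = smult B" "nrm ?K = nrm B"
    by (simp_all add: kernel_bimodule_def normed_space.defs bimodule.defs I_def)
  have carr: "\<exists>x\<in>carrier E. u = j (x, \<zero>\<^bsub>A\<^esub>)" if "u \<in> carrier I" for u
    using that by (auto simp: I_def)
  have carr': "j (x, \<zero>\<^bsub>A\<^esub>) \<in> carrier I" if "x \<in> carrier E" for x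
    using that by (simp add: I_def)
  have "bimodule_iso A ?K E ?\<phi>"
    unfolding bimodule_iso_def
  proof (intro conjI ballI)
    show "linear_map ?K E ?\<phi>"
      by (rule linear_mapI) (auto simp: K_simps j_simps dest!: carr)
    show bij: "bij_betw ?\<phi> (carrier ?K) (carrier E)"
      by (rule bij_betw_byWitness[where f' = "\<lambda>x. j (x, \<zero>\<^bsub>A\<^esub>)"])
        (auto simp: K_simps carr' dest!: carr)
    show "bounded_map ?K E ?\<phi>"
      unfolding bounded_map_def by (intro exI[of _ 1]) (auto simp: K_simps j_simps dest!: carr)
    have "inv_into (carrier ?K) ?\<phi> x = j (x, \<zero>\<^bsub>A\<^esub>)" if "x \<in> carrier E" for x
      using bij that by (intro inv_into_f_eq) (auto simp: bij_betw_def K_simps carr')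
    then show "bounded_map E ?K (inv_into (carrier ?K) ?\<phi>)"
      unfolding bounded_map_def by (intro exI[of _ 1]) (auto simp: K_simps j_simps)
    fix a u assume a: "a \<in> carrier A" and "u \<in> carrier ?K"
    then obtain x where x: "x \<in> carrier E" "u = j (x, \<zero>\<^bsub>A\<^esub>)"
      using carr by (auto simp: K_simps)
    note act = kernel_action[OF singular_extension_I, of "j (\<zero>\<^bsub>E\<^esub>, a)" u]
    show "?\<phi> (lact ?K a u) = lact E a (?\<phi> u)" "?\<phi> (ract ?K u a) = ract E (?\<phi> u) a"
      using act a x carr' by (simp_all add: j_simps)
  qed
  with singular_extension_I show ?thesis
    by (auto simp: singular_extension_by_def)
qed

section \<open>Sections of the twisted extension\<close>

lemma section_properties:
  defines "Q \<equiv> \<lambda>a. j (\<zero>\<^bsub>E\<^esub>, a)"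
  shows "cf_homomorphism A B Q" "bounded_map A B Q" "\<And>a. a \<in> carrier A \<Longrightarrow> q (Q a) = a"
proof -
  have lin: "linear_map A B Q"
    by (rule linear_mapI) (auto simp: Q_def j_simps)
  show "bounded_map A B Q"
    unfolding bounded_map_def by (intro exI[of _ c]) (simp add: Q_def j_simps)
  show "q (Q a) = a" if "a \<in> carrier A" for a
    using that by (simp add: Q_def j_simps)
  have T: "compact_bilinear_map A A E T"
    using cocycle by (simp add: Z2K_def)
  define S where "S = (\<lambda>a b. Q a \<otimes>\<^bsub>B\<^esub> Q b \<ominus>\<^bsub>B\<^esub> Q (a \<otimes>\<^bsub>A\<^esub> b))"
  have S: "S a b = j (T a b, \<zero>\<^bsub>A\<^esub>)" if "a \<in> carrier A" "b \<in> carrier A" for a b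
    using that by (simp add: S_def Q_def j_simps j_minus)
  \<comment> \<open>The map \<open>x \<mapsto> j (x, 0)\<close> is isometric, and \<open>T\<close>
    fills both slots of the criterion, hence the constant \<open>1 / 2\<close>.\<close>
  have "compact_bilinear_map A A B S"
  proof (rule compact_bilinear_map_dominated[OF E.banach_space_axioms E.banach_space_axioms
        B.banach_space_axioms T T, where K = "1 / 2"])
    show "bilinear_map A A B S"
      by (rule bilinear_mapI) (auto simp: S j_simps)
  qed (simp add: S j_minus j_simps)
  with lin show "cf_homomorphism A B Q"
    by (simp add: cf_homomorphism_def S_def)
qed

text \<open>The first coordinate \<open>R\<close> of \<open>\<theta>\<close> measures the deviation
  from the standard section. Multiplicativity of \<open>\<theta>\<close>, read off in that
  coordinate, says that \<open>R (a b)\<close> is \<open>R a b + a R b + T a b\<close>, so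
  \<open>T\<close> is the coboundary of \<open>R\<close> with the opposite sign.\<close>

lemma coboundary_of_splitting:
  assumes hom: "algebra_hom A B \<theta>" and section_q: "\<And>a. a \<in> carrier A \<Longrightarrow> q (\<theta> a) = a"
  defines "S \<equiv> \<lambda>a. \<ominus>\<^bsub>E\<^esub> fst (g (\<theta> a))"
  shows "linear_map A E S"
    and "\<And>a b. a \<in> carrier A \<Longrightarrow> b \<in> carrier A \<Longrightarrow> T a b = delta1 A E S a b"
    and "bounded_map A B \<theta> \<Longrightarrow> bounded_map A E S"
proof -
  interpret \<theta>: normed_linear A B \<theta>
    using hom by unfold_locales (simp add: algebra_hom_def)
  define R where "R a = fst (g (\<theta> a))" for a
  have R: "R a \<in> carrier E" and \<theta>: "\<theta> a = j (R a, a)" if a: "a \<in> carrier A" for a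
  proof -
    obtain x b where u: "x \<in> carrier E" "b \<in> carrier A" "\<theta> a = j (x, b)"
      using \<theta>.closed[OF a] by (rule B_carrierE)
    then have "R a = x" "b = a"
      using section_q[OF a] by (simp_all add: R_def j_simps)
    with u show "R a \<in> carrier E" "\<theta> a = j (R a, a)" by auto
  qed
  have "R (a \<oplus>\<^bsub>A\<^esub> b) = R a \<oplus>\<^bsub>E\<^esub> R b" if "a \<in> carrier A" "b \<in> carrier A" for a b
    using \<theta>.add[OF that] that R by (simp add: \<theta> j_simps)
  moreover have "R (k \<odot>\<^bsub>A\<^esub> a) = k \<odot>\<^bsub>E\<^esub> R a" if "a \<in> carrier A" for a k
    using \<theta>.smult[OF that, of k] that R by (simp add: \<theta> j_simps)
  ultimately have R_lin: "linear_map A E R"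
    using R by (intro linear_mapI)
  have S_eq: "S = (\<lambda>a. \<ominus>\<^bsub>E\<^esub> R a)"
    by (simp add: S_def R_def)
  then show lin: "linear_map A E S"
    using linear_map_uminus[OF R_lin] by simp
  show "T a b = delta1 A E S a b" if a: "a \<in> carrier A" and b: "b \<in> carrier A" for a b
  proof -
    have "\<theta> (a \<otimes>\<^bsub>A\<^esub> b) = \<theta> a \<otimes>\<^bsub>B\<^esub> \<theta> b"
      using hom a b by (simp add: algebra_hom_def)
    then have R_mult: "R (a \<otimes>\<^bsub>A\<^esub> b) = ract E (R a) b \<oplus>\<^bsub>E\<^esub> lact E a (R b) \<oplus>\<^bsub>E\<^esub> T a b"
      using a b R by (simp add: \<theta> j_simps)
    have "delta1 A E S a b = \<ominus>\<^bsub>E\<^esub> delta1 A E R a b"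
      unfolding S_eq using delta1_uminus[OF R_lin a b] .
    also have "delta1 A E R a b = \<ominus>\<^bsub>E\<^esub> T a b"
    proof -
      let ?L = "lact E a (R b)" and ?r = "ract E (R a) b"
      have "delta1 A E R a b = (?r \<oplus>\<^bsub>E\<^esub> ?L) \<ominus>\<^bsub>E\<^esub> ((?r \<oplus>\<^bsub>E\<^esub> ?L) \<oplus>\<^bsub>E\<^esub> T a b)"
        using a b R by (simp add: delta1_def R_mult E.M.minus_eq E.M.a_ac)
      also have "\<dots> = \<ominus>\<^bsub>E\<^esub> T a b"
        using a b R by (simp add: E.minus_add_eq E.M.minus_eq[of "\<zero>\<^bsub>E\<^esub>"])
      finally show ?thesis .
    qed
    finally show ?thesis
      using a b by simp
  qed
  assume "bounded_map A B \<theta>"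
  then obtain K where K: "\<And>a. a \<in> carrier A \<Longrightarrow> nrm B (\<theta> a) \<le> K * nrm A a"
    by (auto simp: bounded_map_def)
  \<comment> \<open>The norm of \<open>\<theta> a\<close> is
    \<open>nrm E (R a) + c * nrm A a\<close>, so it bounds the first coordinate.\<close>
  have "nrm E (S a) \<le> K * nrm A a" if "a \<in> carrier A" for a
  proof -
    have "0 \<le> c * nrm A a"
      using c_pos that by simp
    then show ?thesis
      using K[OF that] that R by (simp add: \<theta> S_eq j_simps)
  qed
  then show "bounded_map A E S"
    by (auto simp: bounded_map_def)
qed

end

lemma (in banach_bimodule) cocycle_extension_constant:
  assumes T: "T \<in> Z2K A E"
  obtains c where "0 < c"
    and "\<And>a x. a \<in> carrier A \<Longrightarrow> x \<in> carrier E \<Longrightarrow> nrm E (lact E a x) \<le> c * nrm A a * nrm E x"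
    and "\<And>a x. a \<in> carrier A \<Longrightarrow> x \<in> carrier E \<Longrightarrow> nrm E (ract E x a) \<le> c * nrm A a * nrm E x"
    and "\<And>a b. a \<in> carrier A \<Longrightarrow> b \<in> carrier A \<Longrightarrow>
      nrm E (T a b) \<le> (c * c - c) * nrm A a * nrm A b"
proof -
  obtain K where K: "\<And>a x. a \<in> carrier A \<Longrightarrow> x \<in> carrier E \<Longrightarrow>
      nrm E (lact E a x) \<le> K * nrm A a * nrm E x \<and> nrm E (ract E x a) \<le> K * nrm A a * nrm E x"
    using actions_bounded by blast
  obtain C where C: "0 \<le> C"
    "\<And>a b. a \<in> carrier A \<Longrightarrow> b \<in> carrier A \<Longrightarrow> nrm E (T a b) \<le> C * nrm A a * nrm A b"
    using T compact_bilinear_map_bounded[OF A.normed_module_axioms A.normed_module_axioms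
        E.banach_space_axioms, of T] by (auto simp: Z2K_def)
  \<comment> \<open>\<open>K\<close> bounds the actions and \<open>C\<close> bounds
    \<open>T\<close>. The summand 1 makes \<open>c\<close> at least 1, so that
    \<open>c * c - c = c * (\<bar>K\<bar> + C)\<close> is at least \<open>C\<close>.\<close>
  define c where "c = 1 + \<bar>K\<bar> + C"
  have c: "0 < c" "K \<le> c" using C by (auto simp: c_def)
  have "c * c - c = c * (\<bar>K\<bar> + C)"
    by (simp add: c_def algebra_simps)
  moreover have "1 * C \<le> c * (\<bar>K\<bar> + C)"
    using C by (intro mult_mono) (auto simp: c_def)
  ultimately have Cc: "C \<le> c * c - c" by simp
  show thesis
  proof (rule that)
    show "0 < c" by fact
    have *: "K * nrm A a * nrm E x \<le> c * nrm A a * nrm E x" if "a \<in> carrier A" "x \<in> carrier E" for a x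
      using that c by (intro mult_right_mono) auto
    show "nrm E (lact E a x) \<le> c * nrm A a * nrm E x" "nrm E (ract E x a) \<le> c * nrm A a * nrm E x"
      if "a \<in> carrier A" "x \<in> carrier E" for a x
      using K[OF that] *[OF that] by linarith+
    show "nrm E (T a b) \<le> (c * c - c) * nrm A a * nrm A b"
      if "a \<in> carrier A" "b \<in> carrier A" for a b
    proof -
      have "C * nrm A a * nrm A b \<le> (c * c - c) * nrm A a * nrm A b"
        using that Cc by (intro mult_right_mono) auto
      with C(2)[OF that] show ?thesis by linarith
    qed
  qed
qed

section \<open>The two equivalences\<close>

theorem corollary5p9:
  fixes A :: "('k::{real_normed_field, banach}, 'a) normed_space"
    and E :: "('k, 'a, 'e) bimodule"
  assumes "banach_algebra A"
    and "banach_bimodule A E"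
    and universe: "embeds_in_universe E A TYPE('u)"
  shows
    "(H2K_tilde A E = {zero_coset E (Z2K A E) (N2K_tilde A E)} \<longleftrightarrow>
       (\<forall>(I :: ('k, 'u) normed_space) \<iota> (B :: ('k, 'u) normed_space) q.
          singular_extension_by A E I \<iota> B q \<longrightarrow> cf_splits A B q \<longrightarrow> splits A B q)) \<and>
     (H2K A E = {zero_coset E (Z2K A E) (N2K A E)} \<longleftrightarrow>
       (\<forall>(I :: ('k, 'u) normed_space) \<iota> (B :: ('k, 'u) normed_space) q.
          singular_extension_by A E I \<iota> B q \<longrightarrow>
          cf_splits_strongly A B q \<longrightarrow> splits_strongly A B q))"
proof -
  interpret AE: banach_bimodule A E by fact
  have bounded_iff: "continuous_map (norm_topology A) (norm_topology B) \<theta> \<longleftrightarrow> bounded_map A B \<theta>"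
    if "algebra_hom A B \<theta>" "banach_algebra B" for \<theta> and B :: "('k, 'u) normed_space"
  proof -
    interpret B: banach_algebra B by fact
    interpret normed_linear A B \<theta>
      using that by unfold_locales (simp add: algebra_hom_def)
    show ?thesis by (rule continuous_iff_bounded)
  qed
  \<comment> \<open>\<open>T\<close> depends on the extension and on \<open>Q\<close> alone and is
    fixed before \<open>S\<close>, since the cohomological hypothesis returns \<open>S\<close> only
    for a given cocycle. The final implication on bounds makes the statement serve both
    parts.\<close>
  have forward: "\<exists>T\<in>Z2K A E. \<forall>S. linear_map A E S \<longrightarrow>
      (\<forall>a\<in>carrier A. \<forall>b\<in>carrier A. T a b = delta1 A E S a b) \<longrightarrow>
      (\<exists>\<theta>. algebra_hom A B \<theta> \<and> (\<forall>a\<in>carrier A. q (\<theta> a) = a) \<and>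
        (bounded_map A B Q \<longrightarrow> bounded_map A E S \<longrightarrow> bounded_map A B \<theta>))"
    if ext: "singular_extension_by A E I \<iota> B q" and Q: "cf_homomorphism A B Q"
      and sec: "\<And>a. a \<in> carrier A \<Longrightarrow> q (Q a) = a"
    for I :: "('k, 'u) normed_space" and B :: "('k, 'u) normed_space" and \<iota> q Q
  proof -
    obtain \<rho> where "embedded_bimodule A E B q \<rho>"
      using singular_extension_embedding[OF assms(1,2) ext] .
    then interpret \<rho>: embedded_bimodule A E B q \<rho> .
    obtain T where T: "T \<in> Z2K A E"
      "\<And>a b. a \<in> carrier A \<Longrightarrow> b \<in> carrier A \<Longrightarrow>
        \<rho> (T a b) = Q a \<otimes>\<^bsub>B\<^esub> Q b \<ominus>\<^bsub>B\<^esub> Q (a \<otimes>\<^bsub>A\<^esub> b)"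
      using \<rho>.cocycle_of_section[OF Q sec] by metis
    have lin: "linear_map A B Q"
      using Q by (simp add: cf_homomorphism_def)
    show ?thesis
    proof (intro bexI[OF _ T(1)] allI impI)
      fix S assume S: "linear_map A E S"
        and cob: "\<forall>a\<in>carrier A. \<forall>b\<in>carrier A. T a b = delta1 A E S a b"
      have cob': "\<rho> (delta1 A E S a b) = Q a \<otimes>\<^bsub>B\<^esub> Q b \<ominus>\<^bsub>B\<^esub> Q (a \<otimes>\<^bsub>A\<^esub> b)"
        if "a \<in> carrier A" "b \<in> carrier A" for a b
        using T(2)[OF that] cob that by simp
      show "\<exists>\<theta>. algebra_hom A B \<theta> \<and> (\<forall>a\<in>carrier A. q (\<theta> a) = a) \<and>
          (bounded_map A B Q \<longrightarrow> bounded_map A E S \<longrightarrow> bounded_map A B \<theta>)"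
        using \<rho>.splitting_of_coboundary[OF lin sec S cob'] by blast
    qed
  qed
  \<comment> \<open>One extension is built from \<open>T\<close> for both parts: its standard
    section is bounded, so it cf-splits in either sense. The embedding of
    \<open>E \<times> A\<close> into \<open>'u\<close> provides the room for it.\<close>
  have backward: "\<exists>(I :: ('k, 'u) normed_space) \<iota> (B :: ('k, 'u) normed_space) q.
      singular_extension_by A E I \<iota> B q \<and> banach_algebra B \<and>
      cf_splits A B q \<and> cf_splits_strongly A B q \<and>
      (\<forall>\<theta>. algebra_hom A B \<theta> \<longrightarrow> (\<forall>a\<in>carrier A. q (\<theta> a) = a) \<longrightarrow>
        (\<exists>S. linear_map A E S \<and> (\<forall>a\<in>carrier A. \<forall>b\<in>carrier A. T a b = delta1 A E S a b) \<and>
          (bounded_map A B \<theta> \<longrightarrow> bounded_map A E S)))"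
    if T: "T \<in> Z2K A E" for T
  proof -
    obtain j :: "'e \<times> 'a \<Rightarrow> 'u" where j: "inj_on j (carrier E \<times> carrier A)"
      using universe by (auto simp: embeds_in_universe_def)
    obtain c where "cocycle_extension A E T c j"
    proof (rule AE.cocycle_extension_constant[OF T])
      fix c :: real
      assume "0 < c"
        "\<And>a x. a \<in> carrier A \<Longrightarrow> x \<in> carrier E \<Longrightarrow> nrm E (lact E a x) \<le> c * nrm A a * nrm E x"
        "\<And>a x. a \<in> carrier A \<Longrightarrow> x \<in> carrier E \<Longrightarrow> nrm E (ract E x a) \<le> c * nrm A a * nrm E x"
        "\<And>a b. a \<in> carrier A \<Longrightarrow> b \<in> carrier A \<Longrightarrow>
          nrm E (T a b) \<le> (c * c - c) * nrm A a * nrm A b"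
      then have "cocycle_extension A E T c j"
        using T j by unfold_locales auto
      then show thesis by (rule that)
    qed
    then interpret X: cocycle_extension A E T c j .
    have "cf_splits A X.B X.q" "cf_splits_strongly A X.B X.q"
      using X.section_properties by (auto simp: cf_splits_def cf_splits_strongly_def)
    moreover have "\<exists>S. linear_map A E S \<and>
        (\<forall>a\<in>carrier A. \<forall>b\<in>carrier A. T a b = delta1 A E S a b) \<and>
        (bounded_map A X.B \<theta> \<longrightarrow> bounded_map A E S)"
      if "algebra_hom A X.B \<theta>" "\<forall>a\<in>carrier A. X.q (\<theta> a) = a" for \<theta>
      using X.coboundary_of_splitting[OF that(1)] that(2) by blast
    ultimately show ?thesis
      using X.singular_extension_by_I X.banach_algebra_B by blast
  qed
  have ext_algebra: "banach_algebra B" if "singular_extension_by A E I \<iota> B q"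
    for I :: "('k, 'u) normed_space" and B :: "('k, 'u) normed_space" and \<iota> q
    using that by (simp add: singular_extension_by_def singular_extension_def banach_extension_def)
  show ?thesis
    unfolding AE.H2K_trivial_iff AE.H2K_tilde_trivial_iff
  proof (intro conjI iffI allI impI ballI)
    fix I :: "('k, 'u) normed_space" and \<iota> and B :: "('k, 'u) normed_space" and q
    assume H: "\<forall>T\<in>Z2K A E. \<exists>S. linear_map A E S \<and>
        (\<forall>a\<in>carrier A. \<forall>b\<in>carrier A. T a b = delta1 A E S a b)"
      and ext: "singular_extension_by A E I \<iota> B q" and "cf_splits A B q"
    then obtain Q where Q: "cf_homomorphism A B Q" "\<And>a. a \<in> carrier A \<Longrightarrow> q (Q a) = a"
      by (auto simp: cf_splits_def)
    obtain T where T: "T \<in> Z2K A E" and ex: "\<And>S. linear_map A E S \<Longrightarrow>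
        \<forall>a\<in>carrier A. \<forall>b\<in>carrier A. T a b = delta1 A E S a b \<Longrightarrow>
        \<exists>\<theta>. algebra_hom A B \<theta> \<and> (\<forall>a\<in>carrier A. q (\<theta> a) = a)"
      using forward[OF ext Q] by blast
    obtain S where "linear_map A E S" "\<forall>a\<in>carrier A. \<forall>b\<in>carrier A. T a b = delta1 A E S a b"
      using bspec[OF H T] by blast
    then show "splits A B q"
      unfolding splits_def by (rule ex)
  next
    fix T assume split: "\<forall>(I :: ('k, 'u) normed_space) \<iota> (B :: ('k, 'u) normed_space) q.
        singular_extension_by A E I \<iota> B q \<longrightarrow> cf_splits A B q \<longrightarrow> splits A B q"
      and T: "T \<in> Z2K A E"
    obtain I :: "('k, 'u) normed_space" and \<iota> and B :: "('k, 'u) normed_space" and q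
      where ext: "singular_extension_by A E I \<iota> B q" and cf: "cf_splits A B q"
        and ex: "\<And>\<theta>. algebra_hom A B \<theta> \<Longrightarrow> \<forall>a\<in>carrier A. q (\<theta> a) = a \<Longrightarrow>
          \<exists>S. linear_map A E S \<and> (\<forall>a\<in>carrier A. \<forall>b\<in>carrier A. T a b = delta1 A E S a b)"
      using backward[OF T] by blast
    obtain \<theta> where "algebra_hom A B \<theta>" "\<forall>a\<in>carrier A. q (\<theta> a) = a"
      using split[rule_format, OF ext cf] unfolding splits_def by blast
    then show "\<exists>S. linear_map A E S \<and>
        (\<forall>a\<in>carrier A. \<forall>b\<in>carrier A. T a b = delta1 A E S a b)"
      by (rule ex)
  next
    fix I :: "('k, 'u) normed_space" and \<iota> and B :: "('k, 'u) normed_space" and q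
    assume H: "\<forall>T\<in>Z2K A E. \<exists>S. linear_map A E S \<and> bounded_map A E S \<and>
        (\<forall>a\<in>carrier A. \<forall>b\<in>carrier A. T a b = delta1 A E S a b)"
      and ext: "singular_extension_by A E I \<iota> B q" and "cf_splits_strongly A B q"
    then obtain Q where Q: "cf_homomorphism A B Q" "\<And>a. a \<in> carrier A \<Longrightarrow> q (Q a) = a"
      and bdd: "bounded_map A B Q"
      by (auto simp: cf_splits_strongly_def)
    obtain T where T: "T \<in> Z2K A E" and ex: "\<And>S. linear_map A E S \<Longrightarrow>
        \<forall>a\<in>carrier A. \<forall>b\<in>carrier A. T a b = delta1 A E S a b \<Longrightarrow> bounded_map A E S \<Longrightarrow>
        \<exists>\<theta>. algebra_hom A B \<theta> \<and> (\<forall>a\<in>carrier A. q (\<theta> a) = a) \<and> bounded_map A B \<theta>"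
      using forward[OF ext Q] bdd by blast
    obtain S where "linear_map A E S" "\<forall>a\<in>carrier A. \<forall>b\<in>carrier A. T a b = delta1 A E S a b"
      "bounded_map A E S"
      using bspec[OF H T] by blast
    from ex[OF this] obtain \<theta> where
      "algebra_hom A B \<theta>" "\<forall>a\<in>carrier A. q (\<theta> a) = a" "bounded_map A B \<theta>"
      by blast
    then show "splits_strongly A B q"
      unfolding splits_strongly_def using bounded_iff ext_algebra[OF ext] by blast
  next
    fix T assume split: "\<forall>(I :: ('k, 'u) normed_space) \<iota> (B :: ('k, 'u) normed_space) q.
        singular_extension_by A E I \<iota> B q \<longrightarrow> cf_splits_strongly A B q \<longrightarrow> splits_strongly A B q"
      and T: "T \<in> Z2K A E"
    obtain I :: "('k, 'u) normed_space" and \<iota> and B :: "('k, 'u) normed_space" and q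
      where ext: "singular_extension_by A E I \<iota> B q" and cf: "cf_splits_strongly A B q"
        and ex: "\<And>\<theta>. algebra_hom A B \<theta> \<Longrightarrow> \<forall>a\<in>carrier A. q (\<theta> a) = a \<Longrightarrow> bounded_map A B \<theta> \<Longrightarrow>
          \<exists>S. linear_map A E S \<and> bounded_map A E S \<and>
            (\<forall>a\<in>carrier A. \<forall>b\<in>carrier A. T a b = delta1 A E S a b)"
      using backward[OF T] by blast
    obtain \<theta> where "algebra_hom A B \<theta>" "\<forall>a\<in>carrier A. q (\<theta> a) = a"
      "continuous_map (norm_topology A) (norm_topology B) \<theta>"
      using split[rule_format, OF ext cf] unfolding splits_strongly_def by blast
    then show "\<exists>S. linear_map A E S \<and> bounded_map A E S \<and>
        (\<forall>a\<in>carrier A. \<forall>b\<in>carrier A. T a b = delta1 A E S a b)"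
      using ex bounded_iff ext_algebra[OF ext] by blast
  qed
qed

end
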